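(* Let $d$ be fixed, let $u\ge0$, and let $G$ be a $d$-regular (multi)graph on $n$ vertices whose spectral gap satisfies $\lambda_G\ge\alpha>0$. Then for every $\varepsilon\in(0,\tfrac14)$ and every $i\in\{0,\dots,d\}$, $$P^G\Big[\big|n_i(\mathcal D^u)-E^G[n_i(\mathcal D^u)]\big|\ge n^{1/2+\varepsilon}\Big]\le c_\varepsilon\,e^{-c\,n^{\varepsilon}} ,$$ where $c>0$ is a constant depending only on $d$ and $c_\varepsilon>0$ is a constant depending only on $\varepsilon$ and $d$.
   Context: Multigraphs may have loops and multiple edges; loops are counted twice in degrees. For a $d$-regular multigraph $G$ with vertex set $V$, $|V|=n$, let $n_{xy}$ be the number of edges between $x$ and $y$ (loops counted twice in $n_{xx}$) and $p_{xy}=n_{xy}/d$. $P^G$ (expectation $E^G$) is the law of the continuous-time simple random walk $(X_t)_{t\ge0}$ on $G$, with generator $\mathcal Lf(x)=\sum_{y}p_{xy}(f(y)-f(x))$, started from the uniform distribution $\pi$ on $V$. The spectral gap is $\lambda_G=\min\{\mathcal D(f,f):\pi(f^2)=1,\ \pi(f)=0\}$ where $\mathcal D(f,f)=\frac12\sum_{x,y}(f(x)-f(y))^2\pi_xp_{xy}$. The vacant set is $\mathcal V^u=V\setminus\{X_t:0\le t\le un\}$. The vacant graph at level $u$ has vertex set $V$ (all vertices) and as edges exactly those edges of $G$ (with multiplicity) whose endpoints both lie in $\mathcal V^u$. $\mathcal D^u:V\to\mathbb N$ is the degree sequence of the vacant graph (loops counted twice), and for a degree sequence $\boldsymbol d$,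 $n_i(\boldsymbol d)=|\{x\in V:\boldsymbol d_x=i\}|$.
   Formalization: The constant c_ε is allowed to depend on the spectral-gap bound α as well as on ε and d; independence from α fails, e.g. for cycles (d=2) with α=λ_G and u=n, where the vacant arc fluctuates at order n. *)

theory Defs
  imports "HOL-Probability.Probability" "HOL-Library.Multiset"
begin

text \<open>An edge carries the two-element multiset of its endpoints; a loop at \<open>x\<close> has endpoints
  \<open>{#x, x#}\<close>, so that \<open>count (ends G e) x\<close> counts loops twice.\<close>

record ('v, 'e) multigraph =
  verts :: "'v set"
  edges :: "'e set"
  ends :: "'e \<Rightarrow> 'v multiset"

definition finite_multigraph :: "('v, 'e) multigraph \<Rightarrow> bool" where
  "finite_multigraph G \<longleftrightarrow>
     finite (verts G) \<and> verts G \<noteq> {} \<and> finite (edges G) \<and>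
     (\<forall>e\<in>edges G. size (ends G e) = 2 \<and> set_mset (ends G e) \<subseteq> verts G)"

definition vdegree :: "('v, 'e) multigraph \<Rightarrow> 'v \<Rightarrow> nat" where
  "vdegree G x = (\<Sum>e\<in>edges G. count (ends G e) x)"

definition regular_multigraph :: "nat \<Rightarrow> ('v, 'e) multigraph \<Rightarrow> bool" where
  "regular_multigraph d G \<longleftrightarrow> finite_multigraph G \<and> (\<forall>x\<in>verts G. vdegree G x = d)"

definition edge_count :: "('v, 'e) multigraph \<Rightarrow> 'v \<Rightarrow> 'v \<Rightarrow> nat" where
  "edge_count G x y =
     (if x = y then 2 else 1) * card {e \<in> edges G. ends G e = {#x, y#}}"

definition jump_prob :: "nat \<Rightarrow> ('v, 'e) multigraph \<Rightarrow> 'v \<Rightarrow> 'v \<Rightarrow> real" where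
  "jump_prob d G x y = real (edge_count G x y) / real d"

definition unif_mean :: "('v, 'e) multigraph \<Rightarrow> ('v \<Rightarrow> real) \<Rightarrow> real" where
  "unif_mean G f = (\<Sum>x\<in>verts G. f x / real (card (verts G)))"

definition dirichlet_form :: "nat \<Rightarrow> ('v, 'e) multigraph \<Rightarrow> ('v \<Rightarrow> real) \<Rightarrow> real" where
  "dirichlet_form d G f =
     1 / 2 * (\<Sum>x\<in>verts G. \<Sum>y\<in>verts G.
       (f x - f y)\<^sup>2 * (1 / real (card (verts G))) * jump_prob d G x y)"

text \<open>The infimum is attained as soon as there are at least two vertices. On a single vertex it
  runs over the empty set and has no meaning.\<close>

definition spectral_gap :: "nat \<Rightarrow> ('v, 'e) multigraph \<Rightarrow> real" where
  "spectral_gap d G =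
     Inf {dirichlet_form d G f | f.
            unif_mean G (\<lambda>x. (f x)\<^sup>2) = 1 \<and> unif_mean G f = 0}"

definition generator ::
  "nat \<Rightarrow> ('v, 'e) multigraph \<Rightarrow> ('v \<Rightarrow> real) \<Rightarrow> ('v \<Rightarrow> real)" where
  "generator d G f = (\<lambda>x. \<Sum>y\<in>verts G. jump_prob d G x y * (f y - f x))"

text \<open>The semigroup generated by the generator \<open>L\<close>: the exponential series of \<open>t L\<close>, which
  converges because the vertex set is finite.\<close>

definition semigroup_of ::
  "nat \<Rightarrow> ('v, 'e) multigraph \<Rightarrow> real \<Rightarrow> ('v \<Rightarrow> real) \<Rightarrow> ('v \<Rightarrow> real)" where
  "semigroup_of d G t f = (\<lambda>x. \<Sum>k. t ^ k / fact k * (generator d G ^^ k) f x)"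

definition transition_prob ::
  "nat \<Rightarrow> ('v, 'e) multigraph \<Rightarrow> real \<Rightarrow> 'v \<Rightarrow> 'v \<Rightarrow> real" where
  "transition_prob d G t x y = semigroup_of d G t (indicator {y}) x"

text \<open>\<open>X\<close>, on the probability space \<open>M\<close>, is the Markov process with the above generator started
  from the uniform distribution. Its finite-dimensional distributions and the regularity of the
  paths (right-continuous with left limits, for the discrete topology on the vertices) determine
  its law on path space.\<close>

definition stationary_walk ::
  "nat \<Rightarrow> ('v, 'e) multigraph \<Rightarrow> 'w measure \<Rightarrow> (real \<Rightarrow> 'w \<Rightarrow> 'v) \<Rightarrow> bool" where
  "stationary_walk d G M X \<longleftrightarrow>
     prob_space M \<and>
     (\<forall>t\<ge>0. X t \<in> M \<rightarrow>\<^sub>M count_space (verts G)) \<and>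
     (\<forall>\<omega>\<in>space M.
        (\<forall>t\<ge>0. eventually (\<lambda>s. X s \<omega> = X t \<omega>) (at_right t)) \<and>
        (\<forall>t>0. \<exists>y. eventually (\<lambda>s. X s \<omega> = y) (at_left t))) \<and>
     (\<forall>(k::nat) (t :: nat \<Rightarrow> real) (x :: nat \<Rightarrow> 'v).
        t 0 = 0 \<longrightarrow> (\<forall>j<k. t j \<le> t (Suc j)) \<longrightarrow> (\<forall>j\<le>k. x j \<in> verts G) \<longrightarrow>
        measure M {\<omega> \<in> space M. \<forall>j\<le>k. X (t j) \<omega> = x j} =
          1 / real (card (verts G)) *
          (\<Prod>j<k. transition_prob d G (t (Suc j) - t j) (x j) (x (Suc j))))"

definition vacant_set ::
  "('v, 'e) multigraph \<Rightarrow> (real \<Rightarrow> 'w \<Rightarrow> 'v) \<Rightarrow> real \<Rightarrow> 'w \<Rightarrow> 'v set" where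
  "vacant_set G X u \<omega> =
     verts G - {X t \<omega> | t. 0 \<le> t \<and> t \<le> u * real (card (verts G))}"

text \<open>All vertices are kept; only edges with both endpoints in \<open>W\<close> survive.\<close>

definition restrict_edges ::
  "('v, 'e) multigraph \<Rightarrow> 'v set \<Rightarrow> ('v, 'e) multigraph" where
  "restrict_edges G W = G\<lparr>edges := {e \<in> edges G. set_mset (ends G e) \<subseteq> W}\<rparr>"

definition vacant_degree ::
  "('v, 'e) multigraph \<Rightarrow> (real \<Rightarrow> 'w \<Rightarrow> 'v) \<Rightarrow> real \<Rightarrow> 'w \<Rightarrow> 'v \<Rightarrow> nat" where
  "vacant_degree G X u \<omega> = vdegree (restrict_edges G (vacant_set G X u \<omega>))"

definition num_degree :: "('v, 'e) multigraph \<Rightarrow> ('v \<Rightarrow> nat) \<Rightarrow> nat \<Rightarrow> nat" where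
  "num_degree G D i = card {x \<in> verts G. D x = i}"

end

theory Submission
  imports Defs "HOL-Real_Asymp.Real_Asymp"
begin

text \<open>The vacant graph depends on the walk only through its range, and adding one site to the range
  changes \<open>n\<^sub>i\<close> by at most \<open>2d + 1\<close>. Observe the walk on a grid of mesh \<open>\<delta>\<close>. Since the walk forgets
  its position after a time of order \<open>log n / \<alpha>\<close>, the conditional mean of \<open>n\<^sub>i\<close> given the past changes
  by at most \<open>B = O(log n)\<close> at a jump, and jumps have probability at most \<open>\<delta>\<close> per step. Hence the exponential
  moment of \<open>\<theta> (n\<^sub>i - E n\<^sub>i)\<close> over a time \<open>T\<close> is at most \<open>exp (\<theta>\<^sup>2 B\<^sup>2 (1 + T))\<close> uniformly in \<open>\<delta>\<close>, and
  letting \<open>\<delta>\<close> tend to \<open>0\<close> gives the same bound for the continuous walk. With \<open>\<theta> = 2 / sqrt n\<close> the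
  Markov inequality proves the claim as long as \<open>T\<close> exceeds \<open>n\<close> by at most logarithmic factors. For
  longer times the expected number of vacant sites is at most \<open>1\<close>; as \<open>n\<^sub>i\<close> (or \<open>n - n\<^sub>0\<close> for \<open>i = 0\<close>) is
  bounded by the number of vacant sites, the claim follows from the concentration of the latter at an
  earlier time. The constant \<open>c\<close> can be taken to be \<open>1 / 2\<close>.\<close>

section \<open>Exponential moments along a rapidly mixing chain\<close>

lemma exp_le_quadratic:
  fixes z :: real
  assumes "\<bar>z\<bar> \<le> 1"
  shows "exp z \<le> 1 + z + z\<^sup>2"
proof (cases "z \<ge> 0")
  case True
  then show ?thesis using exp_bound[of z] assms by simp
next
  case False
  define y where "y = - z"
  have y: "0 \<le> y" "y \<le> 1" using False assms by (auto simp: y_def)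
  \<comment> \<open>In the product the terms linear in \<open>y\<close> cancel and the remaining
    coefficients are nonnegative. Since the second factor is a lower Taylor bound of
    \<open>exp y\<close>, dividing by \<open>exp y\<close> gives the claim.\<close>
  have "1 \<le> (1 - y + y\<^sup>2) * (1 + y + y\<^sup>2 / 2)"
  proof -
    have "(1 - y + y\<^sup>2) * (1 + y + y\<^sup>2 / 2) = 1 + y ^ 2 / 2 + y ^ 3 / 2 + y ^ 4 / 2"
      by (simp add: field_simps power2_eq_square power3_eq_cube power4_eq_xxxx)
    then show ?thesis using y by simp
  qed
  also have "\<dots> \<le> (1 - y + y\<^sup>2) * exp y"
    using y exp_lower_Taylor_quadratic[of y] by (intro mult_left_mono) (auto simp: add_increasing2)
  finally have "exp (- y) \<le> 1 - y + y\<^sup>2"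
    by (simp add: exp_minus field_simps)
  then show ?thesis by (simp add: y_def)
qed

text \<open>The second-order term is centred at \<open>h x\<close>, the value at a fixed state, and
  not at the mean. The state \<open>x\<close> then contributes nothing, so the error carries the
  factor \<open>1 - w x\<close>, the probability of leaving \<open>x\<close>. This factor keeps the
  accumulated error bounded as the time mesh shrinks.\<close>

lemma weighted_exp_le:
  fixes w h :: "'a \<Rightarrow> real"
  assumes fin: "finite V" and x: "x \<in> V"
    and w: "\<And>y. y \<in> V \<Longrightarrow> 0 \<le> w y" "(\<Sum>y\<in>V. w y) = 1"
    and h: "\<And>y. y \<in> V \<Longrightarrow> \<bar>h y - h x\<bar> \<le> B" and \<theta>: "\<bar>\<theta>\<bar> * B \<le> 1"
  shows "(\<Sum>y\<in>V. w y * exp (\<theta> * h y))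
    \<le> exp (\<theta> * (\<Sum>y\<in>V. w y * h y) + \<theta>\<^sup>2 * B\<^sup>2 * (1 - w x))"
proof -
  define g where "g y = h y - h x" for y
  have wx: "(\<Sum>y\<in>V - {x}. w y) = 1 - w x"
    using w(2) sum.remove[OF fin x, of w] by simp
  have sq: "(\<Sum>y\<in>V. w y * (g y)\<^sup>2) \<le> B\<^sup>2 * (1 - w x)"
  proof -
    have "(\<Sum>y\<in>V. w y * (g y)\<^sup>2) = (\<Sum>y\<in>V - {x}. w y * (g y)\<^sup>2)"
      using sum.remove[OF fin x, of "\<lambda>y. w y * (g y)\<^sup>2"] by (simp add: g_def)
    also have "\<dots> \<le> (\<Sum>y\<in>V - {x}. w y * B\<^sup>2)"
      using h w(1) by (intro sum_mono mult_left_mono) (auto simp: g_def abs_le_square_iff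
          intro!: power2_le_iff_abs_le[THEN iffD2] order.trans[OF abs_ge_zero])
    also have "\<dots> = B\<^sup>2 * (1 - w x)"
      by (simp add: wx flip: sum_distrib_right)
    finally show ?thesis .
  qed
  have "(\<Sum>y\<in>V. w y * exp (\<theta> * g y)) \<le> (\<Sum>y\<in>V. w y * (1 + \<theta> * g y + (\<theta> * g y)\<^sup>2))"
  proof (intro sum_mono mult_left_mono exp_le_quadratic)
    fix y assume "y \<in> V"
    then have "\<bar>\<theta>\<bar> * \<bar>g y\<bar> \<le> \<bar>\<theta>\<bar> * B" using h by (intro mult_left_mono) (auto simp: g_def)
    then show "\<bar>\<theta> * g y\<bar> \<le> 1" using \<theta> by (simp add: abs_mult)
  qed (use w in auto)
  also have "\<dots> = 1 + \<theta> * (\<Sum>y\<in>V. w y * g y) + \<theta>\<^sup>2 * (\<Sum>y\<in>V. w y * (g y)\<^sup>2)"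
    using w(2) by (simp add: algebra_simps sum.distrib sum_distrib_left power_mult_distrib)
  also have "\<dots> \<le> 1 + (\<theta> * (\<Sum>y\<in>V. w y * g y) + \<theta>\<^sup>2 * B\<^sup>2 * (1 - w x))"
    using mult_left_mono[OF sq, of "\<theta>\<^sup>2"] by (simp add: mult.assoc)
  also have "\<dots> \<le> exp (\<theta> * (\<Sum>y\<in>V. w y * g y) + \<theta>\<^sup>2 * B\<^sup>2 * (1 - w x))"
    by (rule exp_ge_add_one_self)
  finally have *: "(\<Sum>y\<in>V. w y * exp (\<theta> * g y)) \<le> \<dots>" .
  have mean: "(\<Sum>y\<in>V. w y * h y) = h x + (\<Sum>y\<in>V. w y * g y)"
    using w(2) by (simp add: g_def algebra_simps sum_subtractf flip: sum_distrib_left)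
  have "(\<Sum>y\<in>V. w y * exp (\<theta> * h y)) = exp (\<theta> * h x) * (\<Sum>y\<in>V. w y * exp (\<theta> * g y))"
    by (simp add: sum_distrib_left g_def right_diff_distrib exp_diff)
  also have "\<dots> \<le> exp (\<theta> * h x) * exp (\<theta> * (\<Sum>y\<in>V. w y * g y) + \<theta>\<^sup>2 * B\<^sup>2 * (1 - w x))"
    using * by (intro mult_left_mono) auto
  also have "\<dots> = exp (\<theta> * (\<Sum>y\<in>V. w y * h y) + \<theta>\<^sup>2 * B\<^sup>2 * (1 - w x))"
    unfolding mean by (simp add: algebra_simps flip: exp_add)
  finally show ?thesis .
qed

lemma weighted_mean_diff_le:
  fixes w f g :: "'a \<Rightarrow> real"
  assumes "\<And>y. y \<in> V \<Longrightarrow> 0 \<le> w y" "(\<Sum>y\<in>V. w y) = 1"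
    and "\<And>y. y \<in> V \<Longrightarrow> \<bar>f y - g y\<bar> \<le> C"
  shows "\<bar>(\<Sum>y\<in>V. w y * f y) - (\<Sum>y\<in>V. w y * g y)\<bar> \<le> C"
proof -
  have "\<bar>(\<Sum>y\<in>V. w y * f y) - (\<Sum>y\<in>V. w y * g y)\<bar> = \<bar>\<Sum>y\<in>V. w y * (f y - g y)\<bar>"
    by (simp add: sum_subtractf right_diff_distrib)
  also have "\<dots> \<le> (\<Sum>y\<in>V. \<bar>w y * (f y - g y)\<bar>)" by (rule sum_abs)
  also have "\<dots> \<le> (\<Sum>y\<in>V. w y * C)"
    using assms by (intro sum_mono) (auto simp: abs_mult intro!: mult_left_mono)
  also have "\<dots> = C" using assms(2) by (simp flip: sum_distrib_right)
  finally show ?thesis .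
qed

section \<open>Functionals of the range of a discrete chain\<close>

text \<open>This is the expectation of \<open>F\<close> at the range of \<open>k\<close> steps from
  \<open>x\<close>, joined with the already visited set \<open>S\<close>. The current position
  enters the visited set only when the recursion moves on, so \<open>S\<close> need not contain
  \<open>x\<close>.\<close>

primrec path_mean ::
  "'v set \<Rightarrow> ('v \<Rightarrow> 'v \<Rightarrow> real) \<Rightarrow> nat \<Rightarrow> ('v set \<Rightarrow> real) \<Rightarrow> 'v \<Rightarrow> 'v set \<Rightarrow> real" where
  "path_mean V P 0 F x S = F (insert x S)"
| "path_mean V P (Suc k) F x S = (\<Sum>y\<in>V. P x y * path_mean V P k F y (insert x S))"

lemma path_mean_insert_start: "path_mean V P k F x (insert x S) = path_mean V P k F x S"
  by (cases k) auto

text \<open>A change of the visited set becomes a change of the functional, so two pasts can be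
  compared under one and the same chain.\<close>

lemma path_mean_shift:
  "path_mean V P k (\<lambda>R. F (insert z R)) x S = path_mean V P k F x (insert z S)"
  by (induction k arbitrary: x S) (auto simp: insert_commute)

text \<open>The discretised walk with mesh \<open>t\<close> has kernel \<open>p t\<close>. The whole
  family in \<open>t\<close> is kept because \<open>K\<close> steps of \<open>p t\<close> amount to
  \<open>p (K * t)\<close>, and mixing is only visible at that time scale. The bound
  \<open>p_hold\<close> says that jumps occur at rate at most 1.\<close>

locale mixing_kernel =
  fixes V :: "'v set" and p :: "real \<Rightarrow> 'v \<Rightarrow> 'v \<Rightarrow> real" and \<alpha> :: real
  assumes finite_V: "finite V" and V_nonempty: "V \<noteq> {}" and \<alpha>_pos: "\<alpha> > 0"
    and p_nonneg: "\<lbrakk>0 \<le> t; x \<in> V; y \<in> V\<rbrakk> \<Longrightarrow> 0 \<le> p t x y"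
    and p_row: "\<lbrakk>0 \<le> t; x \<in> V\<rbrakk> \<Longrightarrow> (\<Sum>y\<in>V. p t x y) = 1"
    and p_add: "\<lbrakk>0 \<le> s; 0 \<le> t; x \<in> V; z \<in> V\<rbrakk> \<Longrightarrow> p (s + t) x z = (\<Sum>y\<in>V. p s x y * p t y z)"
    and p_hold: "\<lbrakk>0 \<le> t; x \<in> V\<rbrakk> \<Longrightarrow> 1 - t \<le> p t x x"
    and p_mix: "\<lbrakk>0 \<le> t; x \<in> V; y \<in> V\<rbrakk> \<Longrightarrow> \<bar>p t x y - 1 / real (card V)\<bar> \<le> exp (- \<alpha> * t)"
begin

text \<open>At time 0 the holding bound already gives the diagonal mass 1. Nonnegativity and unit
  row sums leave nothing for the other entries.\<close>

lemma p_zero: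
  assumes "x \<in> V" "y \<in> V"
  shows "p 0 x y = (if x = y then 1 else 0)"
proof -
  have *: "1 = p 0 x x + (\<Sum>y\<in>V - {x}. p 0 x y)"
    using p_row[of 0 x] sum.remove[OF finite_V assms(1), of "p 0 x"] assms by simp
  have nn: "(\<Sum>y\<in>V - {x}. p 0 x y) \<ge> 0"
    using p_nonneg[of 0 x] assms by (intro sum_nonneg) auto
  have "p 0 x x \<ge> 1" using p_hold[of 0 x] assms by simp
  then have 1: "p 0 x x = 1" and "(\<Sum>y\<in>V - {x}. p 0 x y) = 0" using * nn by linarith+
  then have "\<forall>y\<in>V - {x}. p 0 x y = 0"
    using p_nonneg[of 0 x] assms finite_V by (subst (asm) sum_nonneg_eq_0_iff) auto
  then show ?thesis using 1 assms by auto
qed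

lemma path_mean_diff_le:
  assumes "0 \<le> t" "x \<in> V" and "\<And>R. \<bar>F R - H R\<bar> \<le> C"
  shows "\<bar>path_mean V (p t) k F x S - path_mean V (p t) k H x S\<bar> \<le> C"
  using assms(2)
proof (induction k arbitrary: x S)
  case 0
  then show ?case using assms by simp
next
  case (Suc k)
  then show ?case
    using weighted_mean_diff_le[of V "p t x"] p_nonneg p_row assms by simp
qed

lemma path_mean_bound:
  assumes "0 \<le> t" "x \<in> V" and "\<And>R. \<bar>F R\<bar> \<le> C"
  shows "\<bar>path_mean V (p t) k F x S\<bar> \<le> C"
proof -
  have 0: "path_mean V (p t) k (\<lambda>_. 0) x S = 0" for k x S
    by (induction k arbitrary: x S) auto
  show ?thesis
    using path_mean_diff_le[of t x F "\<lambda>_. 0" C k S] assms by (simp add: 0)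
qed

lemma path_mean_insert_le:
  assumes "0 \<le> t" "x \<in> V" "\<And>z R. \<bar>F (insert z R) - F R\<bar> \<le> L"
  shows "\<bar>path_mean V (p t) k F x (insert z S) - path_mean V (p t) k F x S\<bar> \<le> L"
  using path_mean_diff_le[of t x "\<lambda>R. F (insert z R)" F L k S] assms
  by (simp add: path_mean_shift)

text \<open>Discarding the sites visited during the first \<open>K\<close> steps costs \<open>L\<close> only for each genuine
  jump, so the error is governed by the elapsed time \<open>K * t\<close> and not by the number of steps.\<close>

lemma path_mean_skip:
  assumes t: "0 \<le> t" and L: "\<And>z R. \<bar>F (insert z R) - F R\<bar> \<le> L"
    and x: "x \<in> V" "x \<in> S"
  shows "\<bar>path_mean V (p t) (K + k) F x S - (\<Sum>z\<in>V. p (real K * t) x z * path_mean V (p t) k F z S)\<bar>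
    \<le> L * (real K * t)"
  using x
proof (induction K arbitrary: x S)
  case 0
  then have "(\<Sum>z\<in>V. p 0 x z * path_mean V (p t) k F z S)
      = (\<Sum>z\<in>V. if x = z then path_mean V (p t) k F z S else 0)"
    by (intro sum.cong) (auto simp: p_zero)
  then show ?case using 0 finite_V by simp
next
  case (Suc K)
  have L0: "0 \<le> L" using L[of x S] by linarith
  let ?h = "\<lambda>z. path_mean V (p t) k F z S"
  let ?g = "\<lambda>y. \<Sum>z\<in>V. p (real K * t) y z * ?h z"
  have S: "insert x S = S" using Suc by auto
  have comp: "(\<Sum>z\<in>V. p (real (Suc K) * t) x z * ?h z) = (\<Sum>y\<in>V. p t x y * ?g y)"
  proof -
    have "(\<Sum>z\<in>V. p (real (Suc K) * t) x z * ?h z)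
        = (\<Sum>z\<in>V. (\<Sum>y\<in>V. p t x y * p (real K * t) y z) * ?h z)"
      using p_add[of t "real K * t" x] t Suc.prems by (intro sum.cong) (auto simp: algebra_simps)
    also have "\<dots> = (\<Sum>y\<in>V. p t x y * ?g y)"
      by (simp add: sum_distrib_left sum_distrib_right mult.assoc) (rule sum.swap)
    finally show ?thesis .
  qed
  \<comment> \<open>Staying at \<open>x\<close> adds no site, as \<open>x\<close> is in
    \<open>S\<close>. Moving to another \<open>y\<close> turns the past into
    \<open>insert y S\<close>, and forgetting \<open>y\<close> again costs \<open>L\<close>. The
    total weight of these moves is \<open>1 - p t x x\<close>, hence at most
    \<open>t\<close>.\<close>
  have err: "\<bar>path_mean V (p t) (K + k) F y S - ?g y\<bar> \<le> L * (real K * t) + (if y = x then 0 else L)"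
    if y: "y \<in> V" for y
  proof (cases "y = x")
    case True
    then show ?thesis using Suc.IH[OF Suc.prems] by simp
  next
    case False
    have "\<bar>path_mean V (p t) (K + k) F y S - (\<Sum>z\<in>V. p (real K * t) y z * path_mean V (p t) k F z (insert y S))\<bar>
      \<le> L * (real K * t)"
      using Suc.IH[of y "insert y S"] y by (simp add: path_mean_insert_start)
    moreover have "\<bar>(\<Sum>z\<in>V. p (real K * t) y z * path_mean V (p t) k F z (insert y S)) - ?g y\<bar> \<le> L"
      using p_nonneg p_row t y path_mean_insert_le[OF t _ L] by (intro weighted_mean_diff_le) auto
    ultimately show ?thesis using False L0 by simp
  qed
  have "\<bar>path_mean V (p t) (Suc K + k) F x S - (\<Sum>z\<in>V. p (real (Suc K) * t) x z * ?h z)\<bar>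
      = \<bar>\<Sum>y\<in>V. p t x y * (path_mean V (p t) (K + k) F y S - ?g y)\<bar>"
    unfolding comp by (simp add: S right_diff_distrib sum_subtractf)
  also have "\<dots> \<le> (\<Sum>y\<in>V. \<bar>p t x y * (path_mean V (p t) (K + k) F y S - ?g y)\<bar>)"
    by (rule sum_abs)
  also have "\<dots> \<le> (\<Sum>y\<in>V. p t x y * (L * (real K * t) + (if y = x then 0 else L)))"
  proof (intro sum_mono)
    fix y assume y: "y \<in> V"
    have nn: "0 \<le> p t x y" using p_nonneg[OF t] Suc.prems y by simp
    show "\<bar>p t x y * (path_mean V (p t) (K + k) F y S - ?g y)\<bar> \<le> p t x y * (L * (real K * t) + (if y = x then 0 else L))"
      using mult_left_mono[OF err[OF y] nn] nn by (simp only: abs_mult abs_of_nonneg)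
  qed
  also have "\<dots> = L * (real K * t) * (\<Sum>y\<in>V. p t x y) + (\<Sum>y\<in>V - {x}. p t x y) * L"
    using sum.remove[OF finite_V, of x "\<lambda>y. p t x y * (if y = x then 0 else L)"] Suc.prems
    by (simp add: distrib_left sum.distrib sum_distrib_left sum_distrib_right mult_ac)
  also have "\<dots> = L * (real K * t) + (1 - p t x x) * L"
    using p_row[OF t] sum.remove[OF finite_V, of x "p t x"] Suc.prems by simp
  also have "\<dots> \<le> L * (real K * t) + t * L"
    using p_hold[OF t] Suc.prems L0 by (intro add_left_mono mult_right_mono) (auto simp: algebra_simps)
  finally show ?case by (simp add: algebra_simps)
qed

text \<open>From time \<tau> on, the laws started at \<open>x\<close> and at \<open>y\<close> differ
  by at most 2 / n^2 at each site, where n is the number of sites. A functional bounded by n then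
  has means within 2 of each other. Ignoring the sites visited up to that time costs a multiple of
  \<open>L\<close> linear in \<tau>, once for each starting point.\<close>

lemma path_mean_osc:
  assumes t: "0 \<le> t" "t \<le> 1" and L: "\<And>z R. \<bar>F (insert z R) - F R\<bar> \<le> L"
    and F: "\<And>R. \<bar>F R\<bar> \<le> real (card V)"
    and \<tau>: "\<tau> = 2 * ln (real (card V)) / \<alpha>"
    and xy: "x \<in> V" "y \<in> V"
  shows "\<bar>path_mean V (p t) k F x S - path_mean V (p t) k F y S\<bar> \<le> 2 * L * (4 + \<tau>) + 2"
proof -
  let ?n = "real (card V)"
  have n1: "1 \<le> ?n" using finite_V V_nonempty by (simp add: Suc_le_eq card_gt_0_iff)
  have L0: "0 \<le> L" using L[of x S] by linarith
  have \<tau>0: "0 \<le> \<tau>" using n1 \<alpha>_pos by (simp add: \<tau>)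
  have start: "\<bar>path_mean V (p t) (K + m) F z S - (\<Sum>v\<in>V. p (real K * t) z v * path_mean V (p t) m F v S)\<bar>
      \<le> L * (3 + \<tau>)"
    if z: "z \<in> V" and K: "real K * t \<le> \<tau> + 1" for z K m
  proof -
    have "\<bar>path_mean V (p t) (K + m) F z S - (\<Sum>v\<in>V. p (real K * t) z v * path_mean V (p t) m F v (insert z S))\<bar>
      \<le> L * (real K * t)"
      using path_mean_skip[OF t(1) L z, of "insert z S" K m] by (simp add: path_mean_insert_start)
    moreover have "\<bar>(\<Sum>v\<in>V. p (real K * t) z v * path_mean V (p t) m F v (insert z S))
        - (\<Sum>v\<in>V. p (real K * t) z v * path_mean V (p t) m F v S)\<bar> \<le> L"
      using p_nonneg p_row t z path_mean_insert_le[OF t(1) _ L] by (intro weighted_mean_diff_le) auto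
    moreover have "L * (real K * t) \<le> L * (\<tau> + 1)" using K L0 by (intro mult_left_mono)
    ultimately show ?thesis using L0 by (simp add: algebra_simps)
  qed
  show ?thesis
  proof (cases "real k * t \<le> \<tau> + 1")
    \<comment> \<open>The horizon is too short for mixing, but then few jumps happen and both means
      stay close to \<open>F S\<close>.\<close>
    case True
    have "\<bar>path_mean V (p t) k F z S - F S\<bar> \<le> L * (4 + \<tau>)" if z: "z \<in> V" for z
    proof -
      have "\<bar>path_mean V (p t) k F z S - (\<Sum>v\<in>V. p (real k * t) z v * F (insert v S))\<bar> \<le> L * (3 + \<tau>)"
        using start[OF z True, of 0] by simp
      moreover have "\<bar>(\<Sum>v\<in>V. p (real k * t) z v * F (insert v S)) - (\<Sum>v\<in>V. p (real k * t) z v * F S)\<bar> \<le> L"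
        using p_nonneg p_row t z L by (intro weighted_mean_diff_le) auto
      moreover have "(\<Sum>v\<in>V. p (real k * t) z v * F S) = F S"
        using p_row[of "real k * t" z] t z by (simp flip: sum_distrib_right)
      ultimately show ?thesis by (simp add: algebra_simps)
    qed
    from this[OF xy(1)] this[OF xy(2)] show ?thesis by (simp add: algebra_simps)
  next
    case False
    then have t0: "0 < t" using t \<tau>0 by (cases "t = 0") auto
    \<comment> \<open>\<open>K\<close> is the least number of steps lasting at least \<tau>. As
      \<open>t \<le> 1\<close>, rounding up overshoots \<tau> by at most 1.\<close>
    define K where "K = nat \<lceil>\<tau> / t\<rceil>"
    have K: "\<tau> / t \<le> real K" "real K \<le> \<tau> / t + 1"
      using \<tau>0 t0 by (auto simp: K_def)
    have K1: "\<tau> \<le> real K * t" using K(1) t0 by (simp add: field_simps)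
    have "real K * t \<le> (\<tau> / t + 1) * t" using K(2) t0 by (intro mult_right_mono) auto
    also have "\<dots> = \<tau> + t" using t0 by (simp add: field_simps)
    finally have K2: "real K * t \<le> \<tau> + 1" using t by simp
    with False have "real K * t < real k * t" by simp
    then have "K < k" using t0 by simp
    then obtain m where k: "k = K + m" using less_imp_add_positive by blast
    let ?h = "\<lambda>v. path_mean V (p t) m F v S"
    have "\<bar>(\<Sum>v\<in>V. p (real K * t) x v * ?h v) - (\<Sum>v\<in>V. p (real K * t) y v * ?h v)\<bar>
        = \<bar>\<Sum>v\<in>V. (p (real K * t) x v - p (real K * t) y v) * ?h v\<bar>"
      by (simp add: left_diff_distrib sum_subtractf)
    also have "\<dots> \<le> (\<Sum>v\<in>V. \<bar>(p (real K * t) x v - p (real K * t) y v) * ?h v\<bar>)"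
      by (rule sum_abs)
    \<comment> \<open>There are n sites, each with a difference of at most
      \<open>2 * exp (- \<alpha> * (K * t))\<close> and a value of at most n. The definition of
      \<tau> makes n^2 times the exponential at most 1.\<close>
    also have "\<dots> \<le> (\<Sum>v\<in>V. (2 * exp (- \<alpha> * (real K * t))) * ?n)"
    proof (intro sum_mono, unfold abs_mult, intro mult_mono)
      fix v assume v: "v \<in> V"
      show "\<bar>p (real K * t) x v - p (real K * t) y v\<bar> \<le> 2 * exp (- \<alpha> * (real K * t))"
        using p_mix[of "real K * t" x v] p_mix[of "real K * t" y v] xy v t by simp
      show "\<bar>?h v\<bar> \<le> ?n" using path_mean_bound[OF t(1) v F] .
    qed auto
    also have "\<dots> = 2 * ?n\<^sup>2 * exp (- \<alpha> * (real K * t))" by (simp add: power2_eq_square)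
    also have "\<dots> \<le> 2 * ?n\<^sup>2 * exp (- (2 * ln ?n))"
      using mult_left_mono[OF K1, of \<alpha>] \<alpha>_pos by (intro mult_left_mono) (auto simp: \<tau>)
    also have "\<dots> = 2"
      using n1 by (simp add: exp_minus exp_double)
    finally show ?thesis
      using start[OF xy(1) K2, of m] start[OF xy(2) K2, of m] L0 unfolding k
      by (simp add: algebra_simps)
  qed
qed

text \<open>Iteration of \<open>weighted_exp_le\<close>: given the past, the conditional mean as a
  function of the next position oscillates by at most \<open>B\<close>. Each step therefore
  contributes \<open>\<theta>\<^sup>2 * B\<^sup>2\<close> times its probability of a jump, which is
  at most \<open>t\<close>, and the sum depends only on the elapsed time
  \<open>k * t\<close>.\<close>

lemma path_mean_exp_le:
  assumes t: "0 \<le> t" and x: "x \<in> V" and \<theta>: "\<bar>\<theta>\<bar> * B \<le> 1"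
    and osc: "\<And>k x y S. \<lbrakk>x \<in> V; y \<in> V\<rbrakk> \<Longrightarrow>
      \<bar>path_mean V (p t) k F x S - path_mean V (p t) k F y S\<bar> \<le> B"
  shows "path_mean V (p t) k (\<lambda>R. exp (\<theta> * F R)) x S
    \<le> exp (\<theta> * path_mean V (p t) k F x S + \<theta>\<^sup>2 * B\<^sup>2 * (real k * t))"
  using x
proof (induction k arbitrary: x S)
  case 0
  then show ?case by simp
next
  case (Suc k)
  let ?h = "\<lambda>y. path_mean V (p t) k F y (insert x S)"
  have "path_mean V (p t) (Suc k) (\<lambda>R. exp (\<theta> * F R)) x S
      \<le> (\<Sum>y\<in>V. p t x y * exp (\<theta> * ?h y + \<theta>\<^sup>2 * B\<^sup>2 * (real k * t)))"
    using Suc p_nonneg[OF t] by (auto intro!: sum_mono mult_left_mono)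
  also have "\<dots> = (\<Sum>y\<in>V. p t x y * exp (\<theta> * ?h y)) * exp (\<theta>\<^sup>2 * B\<^sup>2 * (real k * t))"
    by (simp add: exp_add sum_distrib_left mult_ac)
  also have "\<dots> \<le> exp (\<theta> * (\<Sum>y\<in>V. p t x y * ?h y) + \<theta>\<^sup>2 * B\<^sup>2 * (1 - p t x x))
      * exp (\<theta>\<^sup>2 * B\<^sup>2 * (real k * t))"
    using osc Suc.prems p_nonneg p_row t \<theta> finite_V
    by (intro mult_right_mono weighted_exp_le) auto
  also have "\<dots> = exp (\<theta> * path_mean V (p t) (Suc k) F x S + \<theta>\<^sup>2 * B\<^sup>2 * (real k * t + (1 - p t x x)))"
    by (simp add: algebra_simps flip: exp_add)
  also have "\<dots> \<le> exp (\<theta> * path_mean V (p t) (Suc k) F x S + \<theta>\<^sup>2 * B\<^sup>2 * (real (Suc k) * t))"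
    using p_hold[OF t Suc.prems]
    by (intro exp_le_cancel_iff[THEN iffD2] add_left_mono mult_left_mono) (auto simp: algebra_simps)
  finally show ?case .
qed

definition stationary_mean :: "real \<Rightarrow> nat \<Rightarrow> ('v set \<Rightarrow> real) \<Rightarrow> real" where
  "stationary_mean t k F = (\<Sum>x\<in>V. 1 / real (card V) * path_mean V (p t) k F x {})"

text \<open>The random starting point is one more application of \<open>weighted_exp_le\<close>,
  with uniform weights and an arbitrary reference state. It accounts for the summand 1 next to the
  elapsed time.\<close>

lemma stationary_mean_exp_le:
  assumes t: "0 \<le> t" "t \<le> 1" and L: "\<And>z R. \<bar>F (insert z R) - F R\<bar> \<le> L"
    and F: "\<And>R. \<bar>F R\<bar> \<le> real (card V)"
    and B: "B = 2 * L * (4 + 2 * ln (real (card V)) / \<alpha>) + 2" and \<theta>: "\<bar>\<theta>\<bar> * B \<le> 1"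
  shows "stationary_mean t k (\<lambda>R. exp (\<theta> * F R))
    \<le> exp (\<theta> * stationary_mean t k F + \<theta>\<^sup>2 * B\<^sup>2 * (1 + real k * t))"
proof -
  obtain x where x: "x \<in> V" using V_nonempty by blast
  have n: "(\<Sum>x\<in>V. 1 / real (card V)) = 1" using V_nonempty finite_V by simp
  note osc = path_mean_osc[OF t L F refl, folded B]
  have "stationary_mean t k (\<lambda>R. exp (\<theta> * F R))
      \<le> (\<Sum>x\<in>V. 1 / real (card V) * exp (\<theta> * path_mean V (p t) k F x {} + \<theta>\<^sup>2 * B\<^sup>2 * (real k * t)))"
    unfolding stationary_mean_def
    using path_mean_exp_le[OF t(1) _ \<theta>, of _ F k "{}"] osc by (intro sum_mono mult_left_mono) auto
  also have "\<dots> = (\<Sum>x\<in>V. 1 / real (card V) * exp (\<theta> * path_mean V (p t) k F x {})) * exp (\<theta>\<^sup>2 * B\<^sup>2 * (real k * t))"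
    by (simp add: exp_add sum_distrib_left mult_ac)
  also have "\<dots> \<le> exp (\<theta> * stationary_mean t k F + \<theta>\<^sup>2 * B\<^sup>2 * (1 - 1 / real (card V))) * exp (\<theta>\<^sup>2 * B\<^sup>2 * (real k * t))"
    unfolding stationary_mean_def
    using osc x n \<theta> finite_V by (intro mult_right_mono weighted_exp_le) auto
  also have "\<dots> = exp (\<theta> * stationary_mean t k F + \<theta>\<^sup>2 * B\<^sup>2 * (real k * t + (1 - 1 / real (card V))))"
    by (simp add: algebra_simps flip: exp_add)
  also have "\<dots> \<le> exp (\<theta> * stationary_mean t k F + \<theta>\<^sup>2 * B\<^sup>2 * (1 + real k * t))"
    by (intro exp_le_cancel_iff[THEN iffD2] add_left_mono mult_left_mono) auto
  finally show ?thesis .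
qed

section \<open>Unvisited sites after long times\<close>

text \<open>Here a single step is long: its duration makes the mixing error at most
  \<open>1 / (2 * card V)\<close>. Every step thus hits \<open>z\<close> with at least half the
  uniform probability, whatever the current state.\<close>

lemma path_mean_avoid_le:
  assumes t: "ln (2 * real (card V)) / \<alpha> \<le> t" and xz: "x \<in> V" "z \<in> V"
  shows "path_mean V (p t) k (\<lambda>R. indicator (- R) z) x S \<le> (1 - 1 / (2 * real (card V))) ^ k"
  using xz(1)
proof (induction k arbitrary: x S)
  case 0
  then show ?case by (simp add: indicator_def)
next
  case (Suc k)
  let ?n = "real (card V)"
  let ?F = "\<lambda>R. indicator (- R) z :: real"
  have n1: "1 \<le> ?n" using finite_V V_nonempty by (simp add: Suc_le_eq card_gt_0_iff)
  have t0: "0 \<le> t" using n1 \<alpha>_pos t by (intro order.trans[OF _ t]) auto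
  have seen: "path_mean V (p t) k ?F x S = 0" if "z \<in> S" for k x S
    using that by (induction k arbitrary: x S) auto
  have z: "path_mean V (p t) k ?F z (insert x S) = 0"
    using seen[of "insert z (insert x S)" k z] path_mean_insert_start[of V "p t" k ?F z "insert x S"] by simp
  have "exp (- \<alpha> * t) \<le> exp (- ln (2 * ?n))"
    using t \<alpha>_pos by (simp add: field_simps)
  also have "\<dots> = 1 / (2 * ?n)" using n1 by (simp add: exp_minus field_simps)
  finally have hit: "1 / (2 * ?n) \<le> p t x z"
    using p_mix[OF t0 Suc.prems xz(2)] n1 by (simp add: field_simps abs_le_iff)
  have "path_mean V (p t) (Suc k) ?F x S = (\<Sum>y\<in>V - {z}. p t x y * path_mean V (p t) k ?F y (insert x S))"
    by (simp add: z sum.remove[OF finite_V xz(2)])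
  also have "\<dots> \<le> (\<Sum>y\<in>V - {z}. p t x y * (1 - 1 / (2 * ?n)) ^ k)"
    using Suc p_nonneg[OF t0] by (intro sum_mono mult_left_mono) auto
  also have "\<dots> = (1 - p t x z) * (1 - 1 / (2 * ?n)) ^ k"
    using p_row[OF t0 Suc.prems] sum.remove[OF finite_V xz(2), of "p t x"] by (simp flip: sum_distrib_right)
  also have "\<dots> \<le> (1 - 1 / (2 * ?n)) * (1 - 1 / (2 * ?n)) ^ k"
    using hit n1 by (intro mult_right_mono zero_le_power) auto
  finally show ?case by simp
qed

lemma path_mean_sum:
  "path_mean V P k (\<lambda>R. \<Sum>z\<in>A. F z R) x S = (\<Sum>z\<in>A. path_mean V P k (F z) x S)"
  by (induction k arbitrary: x S) (auto simp: sum_distrib_left intro: sum.swap)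

text \<open>The number of steps makes the probability of missing a given site at most
  \<open>1 / card V\<close>. Summing over all sites gives 1.\<close>

lemma stationary_mean_vacant_le:
  assumes t: "ln (2 * real (card V)) / \<alpha> \<le> t" and k: "2 * real (card V) * ln (real (card V)) \<le> real k"
  shows "stationary_mean t k (\<lambda>R. real (card (V - R))) \<le> 1"
proof -
  let ?n = "real (card V)"
  have n1: "1 \<le> ?n" using finite_V V_nonempty by (simp add: Suc_le_eq card_gt_0_iff)
  have card: "real (card (V - R)) = (\<Sum>z\<in>V. indicator (- R) z)" for R
    using finite_V by (simp add: indicator_def sum.If_cases Diff_eq Compl_eq)
  have "(1 - 1 / (2 * ?n)) ^ k \<le> exp (- (1 / (2 * ?n))) ^ k"
    using n1 exp_ge_add_one_self[of "- (1 / (2 * ?n))"] by (intro power_mono) auto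
  also have "\<dots> = exp (- (real k / (2 * ?n)))" by (simp flip: exp_of_nat_mult)
  also have "\<dots> \<le> exp (- ln ?n)" using k n1 by (simp add: field_simps)
  also have "\<dots> = 1 / ?n" using n1 by (simp add: exp_minus field_simps)
  finally have pow: "(1 - 1 / (2 * ?n)) ^ k \<le> 1 / ?n" .
  have "path_mean V (p t) k (\<lambda>R. real (card (V - R))) x {} \<le> 1" if x: "x \<in> V" for x
  proof -
    have "path_mean V (p t) k (\<lambda>R. real (card (V - R))) x {} \<le> (\<Sum>z\<in>V. 1 / ?n)"
      unfolding card path_mean_sum
      using path_mean_avoid_le[OF t x, of _ k "{}"] pow by (intro sum_mono) (meson order.trans)
    then show ?thesis using n1 by simp
  qed
  then have "stationary_mean t k (\<lambda>R. real (card (V - R))) \<le> (\<Sum>x\<in>V. 1 / ?n * 1)"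
    unfolding stationary_mean_def by (intro sum_mono mult_left_mono) auto
  then show ?thesis using n1 by simp
qed

end

section \<open>The semigroup of the walk\<close>

lemma edge_count_sym: "edge_count G x y = edge_count G y x"
  by (simp add: edge_count_def add_mset_commute)

lemma jump_prob_sym: "jump_prob d G x y = jump_prob d G y x"
  by (simp add: jump_prob_def edge_count_sym)

lemma jump_prob_nonneg: "0 \<le> jump_prob d G x y"
  by (simp add: jump_prob_def)

locale regular_graph =
  fixes d :: nat and G :: "('v, 'e) multigraph"
  assumes regular: "regular_multigraph d G"
begin

lemma finite_verts: "finite (verts G)" and verts_nonempty: "verts G \<noteq> {}"
  and finite_edges: "finite (edges G)"
  and size_ends: "e \<in> edges G \<Longrightarrow> size (ends G e) = 2"
  and ends_subset: "e \<in> edges G \<Longrightarrow> set_mset (ends G e) \<subseteq> verts G"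
  and degree_eq: "x \<in> verts G \<Longrightarrow> (\<Sum>e\<in>edges G. count (ends G e) x) = d"
  using regular by (auto simp: regular_multigraph_def finite_multigraph_def vdegree_def)

lemma card_pos: "0 < card (verts G)"
  using finite_verts verts_nonempty by (simp add: card_gt_0_iff)

text \<open>Given \<open>x\<close>, an edge determines its other endpoint, so it contributes for at
  most one \<open>y\<close>. The factor 2 for loops in \<open>edge_count\<close> agrees with the
  multiplicity of \<open>x\<close> in the endpoints.\<close>

lemma sum_edge_count_le:
  assumes x: "x \<in> verts G"
  shows "(\<Sum>y\<in>verts G. edge_count G x y) \<le> d"
proof -
  let ?w = "\<lambda>e y. if ends G e = {#x, y#} then (if x = y then 2 else 1) else (0::nat)"
  have "(\<Sum>y\<in>verts G. edge_count G x y) = (\<Sum>y\<in>verts G. \<Sum>e\<in>edges G. ?w e y)"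
    using finite_edges
    by (intro sum.cong) (simp_all add: edge_count_def sum.If_cases Int_def)
  also have "\<dots> = (\<Sum>e\<in>edges G. \<Sum>y\<in>verts G. ?w e y)" by (rule sum.swap)
  also have "\<dots> \<le> (\<Sum>e\<in>edges G. count (ends G e) x)"
  proof (rule sum_mono)
    fix e assume "e \<in> edges G"
    show "(\<Sum>y\<in>verts G. ?w e y) \<le> count (ends G e) x"
    proof (cases "\<exists>y\<in>verts G. ends G e = {#x, y#}")
      case True
      then obtain y where y: "y \<in> verts G" "ends G e = {#x, y#}" by blast
      then have "?w e z = (if z = y then count (ends G e) x else 0)" for z by auto
      then show ?thesis using finite_verts y by simp
    next
      case False
      then show ?thesis by (simp add: sum.neutral)
    qed
  qed
  finally show ?thesis using degree_eq[OF x] by simp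
qed

text \<open>The form is an inequality because for \<open>d = 0\<close> division by zero makes all
  jump probabilities 0.\<close>

lemma sum_jump_prob_le:
  assumes "x \<in> verts G"
  shows "(\<Sum>y\<in>verts G. jump_prob d G x y) \<le> 1"
proof -
  have "(\<Sum>y\<in>verts G. jump_prob d G x y) = real (\<Sum>y\<in>verts G. edge_count G x y) / real d"
    by (simp add: jump_prob_def sum_divide_distrib)
  also have "\<dots> \<le> 1"
    using of_nat_mono[OF sum_edge_count_le[OF assms], where 'a = real]
    by (auto simp: divide_le_eq_1 simp del: of_nat_sum)
  finally show ?thesis .
qed

section \<open>The exponential series and the backward equation\<close>

lemma generator_funpow_bound:
  assumes "x \<in> verts G" and f: "\<And>y. y \<in> verts G \<Longrightarrow> \<bar>f y\<bar> \<le> C"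
  shows "\<bar>(generator d G ^^ k) f x\<bar> \<le> 2 ^ k * C"
  using assms(1)
proof (induction k arbitrary: x)
  case 0
  then show ?case using f by simp
next
  case (Suc k)
  let ?g = "(generator d G ^^ k) f"
  have C: "0 \<le> 2 ^ k * C" using Suc.IH[OF Suc.prems] by linarith
  have "\<bar>generator d G ?g x\<bar> \<le> (\<Sum>y\<in>verts G. \<bar>jump_prob d G x y * (?g y - ?g x)\<bar>)"
    unfolding generator_def by (rule sum_abs)
  also have "\<dots> \<le> (\<Sum>y\<in>verts G. jump_prob d G x y * (2 * (2 ^ k * C)))"
  proof (rule sum_mono)
    fix y assume y: "y \<in> verts G"
    show "\<bar>jump_prob d G x y * (?g y - ?g x)\<bar> \<le> jump_prob d G x y * (2 * (2 ^ k * C))"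
      using Suc.IH[OF y] Suc.IH[OF Suc.prems]
      by (simp add: abs_mult jump_prob_nonneg mult_left_mono)
  qed
  also have "\<dots> = (\<Sum>y\<in>verts G. jump_prob d G x y) * (2 * (2 ^ k * C))"
    by (simp add: sum_distrib_right)
  also have "\<dots> \<le> 1 * (2 * (2 ^ k * C))"
    using sum_jump_prob_le[OF Suc.prems] C by (intro mult_right_mono) auto
  finally show ?case by simp
qed

lemma semigroup_summable:
  assumes "x \<in> verts G"
  shows "summable (\<lambda>k. (generator d G ^^ k) f x / fact k * t ^ k)"
proof (rule summable_comparison_test')
  define C where "C = Max ((\<lambda>y. \<bar>f y\<bar>) ` verts G)"
  have C: "\<bar>f y\<bar> \<le> C" if "y \<in> verts G" for y
    using finite_verts that by (auto simp: C_def)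
  show "summable (\<lambda>k. C * (inverse (fact k) * (2 * \<bar>t\<bar>) ^ k))"
    by (intro summable_mult summable_exp)
  show "norm ((generator d G ^^ k) f x / fact k * t ^ k) \<le> C * (inverse (fact k) * (2 * \<bar>t\<bar>) ^ k)" for k
  proof -
    have "\<bar>(generator d G ^^ k) f x\<bar> \<le> 2 ^ k * C"
      by (rule generator_funpow_bound[OF assms]) (rule C)
    then have "\<bar>(generator d G ^^ k) f x\<bar> * (\<bar>t\<bar> ^ k / fact k) \<le> 2 ^ k * C * (\<bar>t\<bar> ^ k / fact k)"
      by (intro mult_right_mono) auto
    then show ?thesis by (simp add: abs_mult power_abs power_mult_distrib field_simps)
  qed
qed

lemma semigroup_eq: "semigroup_of d G t f x = (\<Sum>k. (generator d G ^^ k) f x / fact k * t ^ k)"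
  by (simp add: semigroup_of_def mult.commute)

lemma semigroup_zero: "semigroup_of d G 0 f x = f x"
  unfolding semigroup_eq using powser_zero[of "\<lambda>k. (generator d G ^^ k) f x / fact k"] by simp

text \<open>Differentiating the power series termwise shifts the powers of the generator by one. The
  generator is a finite sum and so commutes with the series.\<close>

lemma semigroup_deriv:
  assumes x: "x \<in> verts G"
  shows "((\<lambda>t. semigroup_of d G t f x) has_field_derivative generator d G (semigroup_of d G t f) x) (at t)"
proof -
  let ?a = "\<lambda>y k. (generator d G ^^ k) f y / fact k"
  have "((\<lambda>t. semigroup_of d G t f x) has_field_derivative (\<Sum>k. diffs (?a x) k * t ^ k)) (at t)"
    unfolding semigroup_eq by (intro termdiffs_strong_converges_everywhere semigroup_summable x)
  moreover have "(\<Sum>k. diffs (?a x) k * t ^ k) = generator d G (semigroup_of d G t f) x"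
  proof -
    have lin: "generator d G g x / c * s = (\<Sum>y\<in>verts G. jump_prob d G x y * (g y / c * s - g x / c * s))"
      for g :: "'v \<Rightarrow> real" and c s :: real
      unfolding generator_def sum_divide_distrib sum_distrib_right
      by (intro sum.cong) (simp_all add: diff_divide_distrib algebra_simps)
    have "diffs (?a x) k * t ^ k
        = (\<Sum>y\<in>verts G. jump_prob d G x y * (?a y k * t ^ k - ?a x k * t ^ k))" for k
    proof -
      have "diffs (?a x) k = generator d G ((generator d G ^^ k) f) x / fact k"
        by (simp add: diffs_def field_simps del: of_nat_Suc)
      then show ?thesis by (simp only: lin)
    qed
    then have "(\<Sum>k. diffs (?a x) k * t ^ k)
        = (\<Sum>k. \<Sum>y\<in>verts G. jump_prob d G x y * (?a y k * t ^ k - ?a x k * t ^ k))" by simp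
    also have "\<dots> = (\<Sum>y\<in>verts G. \<Sum>k. jump_prob d G x y * (?a y k * t ^ k - ?a x k * t ^ k))"
      by (intro suminf_sum summable_mult summable_diff semigroup_summable x)
    also have "\<dots> = (\<Sum>y\<in>verts G. jump_prob d G x y * (semigroup_of d G t f y - semigroup_of d G t f x))"
    proof (intro sum.cong refl)
      fix y assume y: "y \<in> verts G"
      note sm = semigroup_summable[OF y, of f t] semigroup_summable[OF x, of f t]
      show "(\<Sum>k. jump_prob d G x y * (?a y k * t ^ k - ?a x k * t ^ k))
        = jump_prob d G x y * (semigroup_of d G t f y - semigroup_of d G t f x)"
        unfolding semigroup_eq suminf_diff[OF sm] by (intro suminf_mult summable_diff sm)
    qed
    finally show ?thesis by (simp add: generator_def)
  qed
  ultimately show ?thesis by simp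
qed

section \<open>Reversibility, spectral gap and mixing\<close>

text \<open>Summation by parts: jump probabilities are symmetric, so the double sum can be averaged
  with its copy in which \<open>x\<close> and \<open>y\<close> are exchanged. Constant
  \<open>g\<close> gives invariance of the uniform measure, and \<open>g = f\<close> gives the
  Dirichlet form.\<close>

lemma sum_generator_eq: "(\<Sum>x\<in>verts G. g x * generator d G f x)
    = - 1 / 2 * (\<Sum>x\<in>verts G. \<Sum>y\<in>verts G. (g x - g y) * (f x - f y) * jump_prob d G x y)"
proof -
  let ?q = "jump_prob d G"
  let ?S = "\<Sum>x\<in>verts G. \<Sum>y\<in>verts G. g x * (?q x y * (f y - f x))"
  have 1: "(\<Sum>x\<in>verts G. g x * generator d G f x) = ?S"
    by (simp add: generator_def sum_distrib_left)
  have "?S = (\<Sum>x\<in>verts G. \<Sum>y\<in>verts G. g y * (?q x y * (f x - f y)))"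
    by (subst sum.swap) (simp add: jump_prob_sym)
  then have "2 * ?S = ?S + (\<Sum>x\<in>verts G. \<Sum>y\<in>verts G. g y * (?q x y * (f x - f y)))" by simp
  also have "\<dots> = (\<Sum>x\<in>verts G. \<Sum>y\<in>verts G. - ((g x - g y) * (f x - f y) * ?q x y))"
    by (simp add: algebra_simps flip: sum.distrib)
  also have "\<dots> = - (\<Sum>x\<in>verts G. \<Sum>y\<in>verts G. (g x - g y) * (f x - f y) * ?q x y)"
    by (simp add: sum_negf)
  finally show ?thesis using 1 by simp
qed

lemma sum_generator: "(\<Sum>x\<in>verts G. generator d G f x) = 0"
  using sum_generator_eq[of "\<lambda>_. 1" f] by simp

lemma dirichlet_form_eq:
  "dirichlet_form d G f = - (\<Sum>x\<in>verts G. f x * generator d G f x) / real (card (verts G))"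
  unfolding sum_generator_eq dirichlet_form_def
  by (simp add: power2_eq_square sum_divide_distrib mult.commute)

lemma dirichlet_form_nonneg: "0 \<le> dirichlet_form d G f"
  by (auto simp: dirichlet_form_def intro!: sum_nonneg mult_nonneg_nonneg divide_nonneg_nonneg jump_prob_nonneg)

text \<open>Rescaling \<open>f\<close> to second moment 1 makes it a competitor in the infimum. A
  vanishing second moment is treated apart; on a single vertex this is the only case, so the
  meaningless infimum over the empty set is never consulted.\<close>

lemma poincare:
  assumes "spectral_gap d G \<ge> \<alpha>" "unif_mean G f = 0"
  shows "\<alpha> * unif_mean G (\<lambda>x. (f x)\<^sup>2) \<le> dirichlet_form d G f"
proof (cases "unif_mean G (\<lambda>x. (f x)\<^sup>2) = 0")
  case True
  then show ?thesis
    by (simp add: dirichlet_form_nonneg)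
next
  case False
  define m where "m = unif_mean G (\<lambda>x. (f x)\<^sup>2)"
  have m: "0 < m" using False unfolding m_def unif_mean_def
    by (intro order.not_eq_order_implies_strict) (auto intro!: sum_nonneg)
  define g where "g x = f x / sqrt m" for x
  have "unif_mean G (\<lambda>x. (g x)\<^sup>2) = unif_mean G (\<lambda>x. (f x)\<^sup>2) / m"
    using m by (simp add: unif_mean_def g_def power_divide sum_divide_distrib mult.commute)
  then have g1: "unif_mean G (\<lambda>x. (g x)\<^sup>2) = 1" using m by (simp add: m_def)
  have "unif_mean G g = unif_mean G f / sqrt m"
    by (simp add: unif_mean_def g_def sum_divide_distrib mult.commute)
  then have g0: "unif_mean G g = 0" using assms by simp
  have "spectral_gap d G \<le> dirichlet_form d G g"
    unfolding spectral_gap_def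
  proof (rule cInf_lower)
    show "bdd_below {dirichlet_form d G f |f. unif_mean G (\<lambda>x. (f x)\<^sup>2) = 1 \<and> unif_mean G f = 0}"
      by (rule bdd_belowI[of _ 0]) (auto simp: dirichlet_form_nonneg)
  qed (use g0 g1 in auto)
  moreover have "dirichlet_form d G g = dirichlet_form d G f / m"
    using m by (simp add: dirichlet_form_def g_def power_divide sum_divide_distrib mult_ac flip: diff_divide_distrib)
  ultimately have "\<alpha> \<le> dirichlet_form d G f / m" using assms by simp
  then show ?thesis using m by (simp add: m_def[symmetric] field_simps)
qed

lemma transition_prob_deriv:
  assumes "x \<in> verts G"
  shows "((\<lambda>t. transition_prob d G t x y) has_field_derivative
    generator d G (\<lambda>z. transition_prob d G t z y) x) (at t)"
  using semigroup_deriv[OF assms] by (simp add: transition_prob_def)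

lemma transition_prob_zero: "transition_prob d G 0 x y = indicator {y} x"
  by (simp add: transition_prob_def semigroup_zero)

text \<open>The backward equation differentiates in the starting point, so the conserved quantity is
  the sum over starting points, by invariance of the uniform measure.\<close>

lemma transition_prob_col_sum:
  assumes y: "y \<in> verts G"
  shows "(\<Sum>x\<in>verts G. transition_prob d G t x y) = 1"
proof -
  have "((\<lambda>t. \<Sum>x\<in>verts G. transition_prob d G t x y) has_field_derivative
      (\<Sum>x\<in>verts G. generator d G (\<lambda>z. transition_prob d G t z y) x)) (at t)" for t
    by (intro DERIV_sum transition_prob_deriv)
  then have "((\<lambda>t. \<Sum>x\<in>verts G. transition_prob d G t x y) has_field_derivative 0) (at t)" for t
    by (simp add: sum_generator)
  then have "(\<Sum>x\<in>verts G. transition_prob d G t x y) = (\<Sum>x\<in>verts G. transition_prob d G 0 x y)"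
    by (intro DERIV_isconst_all) auto
  then show ?thesis using y finite_verts by (simp add: transition_prob_zero indicator_def)
qed

text \<open>The sum \<open>\<phi>\<close> of the squared deviations from uniform, taken over the
  starting point, satisfies a differential inequality with rate \<open>2 * \<alpha>\<close> by the
  Poincare inequality. As it is at most 1 at time 0, it stays below
  \<open>exp (- 2 * \<alpha> * t)\<close>, and so does each single square.\<close>

lemma transition_prob_mixing:
  assumes gap: "spectral_gap d G \<ge> \<alpha>" and t: "0 \<le> t" and xy: "x \<in> verts G" "y \<in> verts G"
  shows "\<bar>transition_prob d G t x y - 1 / real (card (verts G))\<bar> \<le> exp (- \<alpha> * t)"
proof -
  let ?V = "verts G" and ?n = "real (card (verts G))"
  have n: "0 < ?n" using card_pos by simp
  define g where "g t x = transition_prob d G t x y - 1 / ?n" for t x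
  define \<phi> where "\<phi> t = (\<Sum>x\<in>?V. (g t x)\<^sup>2)" for t
  have gen: "generator d G (\<lambda>z. transition_prob d G t z y) = generator d G (g t)" for t
    by (simp add: generator_def g_def fun_eq_iff)
  have dg: "((\<lambda>t. g t x) has_field_derivative generator d G (g t) x) (at t)" if "x \<in> ?V" for x t
  proof -
    have "((\<lambda>t. g t x) has_field_derivative generator d G (\<lambda>z. transition_prob d G t z y) x - 0) (at t)"
      unfolding g_def by (intro DERIV_diff transition_prob_deriv that DERIV_const)
    then show ?thesis by (simp only: gen diff_0_right)
  qed
  have mean: "unif_mean G (g t) = 0" for t
    using transition_prob_col_sum[OF xy(2), of t] n
    by (simp add: unif_mean_def g_def sum_subtractf flip: sum_divide_distrib)
  have d\<phi>: "(\<phi> has_field_derivative (2 * (\<Sum>x\<in>?V. g t x * generator d G (g t) x))) (at t)" for t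
    unfolding \<phi>_def sum_distrib_left
  proof (intro DERIV_sum)
    fix x assume "x \<in> ?V"
    from DERIV_power[OF dg[OF this, of t], of 2]
    show "((\<lambda>t. (g t x)\<^sup>2) has_field_derivative 2 * (g t x * generator d G (g t) x)) (at t)"
      by (simp add: mult.commute)
  qed
  have decay: "2 * (\<Sum>x\<in>?V. g t x * generator d G (g t) x) + 2 * \<alpha> * \<phi> t \<le> 0" for t
  proof -
    have "unif_mean G (\<lambda>x. (g t x)\<^sup>2) = \<phi> t / ?n"
      by (simp add: unif_mean_def \<phi>_def sum_divide_distrib)
    then have "\<alpha> * \<phi> t / ?n \<le> - (\<Sum>x\<in>?V. g t x * generator d G (g t) x) / ?n"
      using poincare[OF gap mean, of t] by (simp add: dirichlet_form_eq)
    then have "\<alpha> * \<phi> t \<le> - (\<Sum>x\<in>?V. g t x * generator d G (g t) x)"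
      using n by (simp only: divide_le_cancel)
    then show ?thesis by linarith
  qed
  have "\<phi> t * exp (2 * \<alpha> * t) \<le> \<phi> 0 * exp (2 * \<alpha> * 0)"
  proof (rule DERIV_nonpos_imp_nonincreasing[OF t], intro exI conjI)
    fix s
    let ?D = "2 * (\<Sum>x\<in>?V. g s x * generator d G (g s) x)"
    have "((\<lambda>t. exp (2 * \<alpha> * t)) has_field_derivative exp (2 * \<alpha> * s) * (2 * \<alpha>)) (at s)"
      by (auto intro!: derivative_eq_intros)
    from DERIV_mult[OF d\<phi> this]
    show "((\<lambda>t. \<phi> t * exp (2 * \<alpha> * t)) has_field_derivative
      ?D * exp (2 * \<alpha> * s) + exp (2 * \<alpha> * s) * (2 * \<alpha>) * \<phi> s) (at s)" .
    have "?D * exp (2 * \<alpha> * s) + exp (2 * \<alpha> * s) * (2 * \<alpha>) * \<phi> s = (?D + 2 * \<alpha> * \<phi> s) * exp (2 * \<alpha> * s)"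
      by (simp only: distrib_left distrib_right mult_ac)
    also have "\<dots> \<le> 0" using decay[of s] by (intro mult_nonpos_nonneg) auto
    finally show "?D * exp (2 * \<alpha> * s) + exp (2 * \<alpha> * s) * (2 * \<alpha>) * \<phi> s \<le> 0" .
  qed
  moreover have "\<phi> 0 \<le> 1"
  proof -
    have "(g 0 x)\<^sup>2 = (if y = x then 1 - 2 / ?n else 0) + 1 / ?n\<^sup>2" for x
      by (auto simp: g_def transition_prob_zero power2_diff power_divide)
    then have "\<phi> 0 = (1 - 2 / ?n) + ?n * (1 / ?n\<^sup>2)"
      using xy finite_verts by (simp add: \<phi>_def sum.distrib)
    also have "\<dots> \<le> 1" using n by (simp add: power2_eq_square)
    finally show ?thesis .
  qed
  ultimately have "\<phi> t * exp (2 * \<alpha> * t) \<le> 1" by simp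
  then have "\<phi> t \<le> exp (- 2 * \<alpha> * t)" by (simp add: exp_minus field_simps)
  moreover have "(g t x)\<^sup>2 \<le> \<phi> t"
    unfolding \<phi>_def using xy finite_verts by (intro member_le_sum) auto
  ultimately have "(g t x)\<^sup>2 \<le> (exp (- \<alpha> * t))\<^sup>2"
    by (simp add: power2_eq_square mult.assoc flip: exp_add)
  then show ?thesis unfolding g_def by (rule abs_le_square_iff[THEN iffD2, THEN order.trans]) simp
qed

text \<open>The derivative of the return probability is at least -1: nonnegativity and unit column
  sums bound the return probability by 1, and the total jump probability out of \<open>x\<close> is
  at most 1.\<close>

lemma transition_prob_holding:
  assumes nn: "\<And>s z. \<lbrakk>0 \<le> s; z \<in> verts G\<rbrakk> \<Longrightarrow> 0 \<le> transition_prob d G s z x"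
    and x: "x \<in> verts G" and t: "0 \<le> t"
  shows "1 - t \<le> transition_prob d G t x x"
proof -
  let ?p = "\<lambda>s z. transition_prob d G s z x"
  have le1: "?p s x \<le> 1" if "0 \<le> s" for s
    using member_le_sum[of x "verts G" "?p s"] nn[OF that] x finite_verts transition_prob_col_sum[OF x, of s]
    by auto
  have "?p 0 x + 0 \<le> ?p t x + t"
  proof (rule DERIV_nonneg_imp_nondecreasing[OF t], intro exI conjI)
    fix s :: real assume s: "0 \<le> s"
    show "((\<lambda>s. ?p s x + s) has_field_derivative generator d G (?p s) x + 1) (at s)"
      by (auto intro!: derivative_eq_intros transition_prob_deriv x)
    have "- ?p s x * (\<Sum>y\<in>verts G. jump_prob d G x y) \<le> generator d G (?p s) x"
      unfolding generator_def sum_distrib_left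
      by (intro sum_mono) (use nn[OF s] jump_prob_nonneg[of d G x] in \<open>simp add: algebra_simps\<close>)
    moreover have "?p s x * (\<Sum>y\<in>verts G. jump_prob d G x y) \<le> 1 * 1"
      using le1[OF s] sum_jump_prob_le[OF x] by (intro mult_mono) (auto intro: sum_nonneg jump_prob_nonneg)
    ultimately show "0 \<le> generator d G (?p s) x + 1" by simp
  qed
  then show ?thesis by (simp add: transition_prob_zero)
qed

end

section \<open>Degree counts as functions of the range\<close>

context regular_graph begin

text \<open>The argument is an arbitrary set, real values included, so that this can be used as the
  functional \<open>F\<close> in bounds that range over all sets \<open>R\<close>.\<close>

definition degree_count :: "nat \<Rightarrow> 'v set \<Rightarrow> real" where
  "degree_count i R = real (num_degree G (vdegree (restrict_edges G (verts G - R))) i)"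

lemma vdegree_restrict:
  "vdegree (restrict_edges G W) x = (\<Sum>e\<in>{e \<in> edges G. set_mset (ends G e) \<subseteq> W}. count (ends G e) x)"
  by (simp add: vdegree_def restrict_edges_def)

lemma degree_count_bound: "\<bar>degree_count i R\<bar> \<le> real (card (verts G))"
  unfolding degree_count_def num_degree_def using finite_verts by (auto intro!: card_mono)

lemma card_neighbours_le:
  "card (\<Union>e\<in>{e \<in> edges G. z \<in># ends G e}. set_mset (ends G e)) \<le> 2 * d"
proof -
  let ?E = "{e \<in> edges G. z \<in># ends G e}"
  have "card ?E \<le> d"
  proof (cases "z \<in> verts G")
    case True
    have "card ?E = (\<Sum>e\<in>?E. 1)" by simp
    also have "\<dots> \<le> (\<Sum>e\<in>?E. count (ends G e) z)"
      by (intro sum_mono) (auto simp: Suc_le_eq)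
    also have "\<dots> \<le> (\<Sum>e\<in>edges G. count (ends G e) z)"
      using finite_edges by (intro sum_mono2) auto
    finally show ?thesis using degree_eq[OF True] by simp
  next
    case False
    then have E: "?E = {}" using ends_subset by blast
    show ?thesis unfolding E by simp
  qed
  have "card (\<Union>e\<in>?E. set_mset (ends G e)) \<le> (\<Sum>e\<in>?E. card (set_mset (ends G e)))"
    using finite_edges by (intro card_UN_le) auto
  also have "\<dots> \<le> (\<Sum>e\<in>?E. 2)"
    using size_ends by (intro sum_mono) (metis (mono_tags, lifting) mem_Collect_eq mset_set_set_mset_msubset size_mset_mono size_mset_set)
  also have "\<dots> \<le> 2 * d" using \<open>card ?E \<le> d\<close> by simp
  finally show ?thesis .
qed

text \<open>Only endpoints of edges at \<open>z\<close> can change their degree, at most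
  \<open>2 * d\<close> vertices. The extra 1 lets the same constant serve for the number of vacant
  sites, also when \<open>d = 0\<close>.\<close>

lemma degree_count_insert_le: "\<bar>degree_count i (insert z R) - degree_count i R\<bar> \<le> 2 * real d + 1"
proof -
  let ?N = "\<Union>e\<in>{e \<in> edges G. z \<in># ends G e}. set_mset (ends G e)"
  let ?D = "\<lambda>R. vdegree (restrict_edges G (verts G - R))"
  let ?A = "\<lambda>R. {x \<in> verts G. ?D R x = i}"
  have finN: "finite ?N" using finite_edges by auto
  \<comment> \<open>An edge lost by visiting \<open>z\<close> contains \<open>z\<close>, so it has
    no endpoint outside \<open>?N\<close>.\<close>
  have eq: "?D (insert z R) x = ?D R x" if "x \<notin> ?N" for x
    unfolding vdegree_restrict
  proof (rule sum.mono_neutral_left)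
    show "\<forall>e\<in>{e \<in> edges G. set_mset (ends G e) \<subseteq> verts G - R}
        - {e \<in> edges G. set_mset (ends G e) \<subseteq> verts G - insert z R}. count (ends G e) x = 0"
      using that by (auto simp: count_eq_zero_iff)
  qed (use finite_edges in auto)
  have step: "card (?A S) \<le> card (?A S') + 2 * d"
    if "\<And>x. x \<notin> ?N \<Longrightarrow> ?D S x = ?D S' x" for S S'
  proof -
    have "card (?A S) \<le> card (?A S' \<union> ?N)"
      using that finite_verts finN by (intro card_mono) auto
    also have "\<dots> \<le> card (?A S') + card ?N" by (rule card_Un_le)
    finally show ?thesis using card_neighbours_le[of z] by simp
  qed
  show ?thesis
    using step[of "insert z R" R] step[of R "insert z R"] eq
    unfolding degree_count_def num_degree_def by fastforce
qed

lemma vdegree_restrict_pos: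
  assumes "vdegree (restrict_edges G W) x \<noteq> 0"
  shows "x \<in> W"
proof (rule ccontr)
  assume "x \<notin> W"
  then have "vdegree (restrict_edges G W) x = 0"
    unfolding vdegree_restrict by (intro sum.neutral) (auto simp: count_eq_zero_iff)
  with assms show False by simp
qed

text \<open>A vertex with positive degree in the vacant graph is itself vacant. So the number of
  vacant sites bounds the count for positive \<open>i\<close> and, for \<open>i = 0\<close>, the
  size of the complement.\<close>

lemma degree_count_near:
  "\<bar>degree_count i R - (if i = 0 then real (card (verts G)) else 0)\<bar> \<le> real (card (verts G - R))"
proof -
  let ?D = "vdegree (restrict_edges G (verts G - R))"
  have sub: "{x \<in> verts G. ?D x \<noteq> 0} \<subseteq> verts G - R" using vdegree_restrict_pos by blast
  show ?thesis
  proof (cases "i = 0")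
    case True
    have "card (verts G) = card {x \<in> verts G. ?D x = 0} + card {x \<in> verts G. ?D x \<noteq> 0}"
      using finite_verts by (subst card_Un_disjoint[symmetric]) (auto intro: arg_cong[where f=card])
    moreover have "card {x \<in> verts G. ?D x \<noteq> 0} \<le> card (verts G - R)"
      using sub finite_verts by (intro card_mono) auto
    ultimately show ?thesis using True by (simp add: degree_count_def num_degree_def)
  next
    case False
    then have "card {x \<in> verts G. ?D x = i} \<le> card (verts G - R)"
      using sub finite_verts by (intro card_mono) auto
    then show ?thesis using False by (simp add: degree_count_def num_degree_def)
  qed
qed

end

section \<open>The range of the walk\<close>

text \<open>The last position is summed out. The visited set in \<psi> stops one index earlier, so
  it does not depend on that position.\<close>

lemma sum_paths_Suc:
  fixes V :: "'v set" and \<psi> :: "'v \<Rightarrow> 'v set \<Rightarrow> real"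
  assumes "finite V"
  shows "(\<Sum>x\<in>PiE {..Suc N} (\<lambda>_. V). c * (\<Prod>j<Suc N. P (x j) (x (Suc j))) * \<psi> (x (Suc N)) (x ` {..N}))
    = (\<Sum>x\<in>PiE {..N} (\<lambda>_. V). c * (\<Prod>j<N. P (x j) (x (Suc j))) *
        (\<Sum>y\<in>V. P (x N) y * \<psi> y (insert (x N) (x ` {..<N}))))"
proof -
  have Suc: "{..Suc N} = insert (Suc N) {..N}" by auto
  have ins: "insert (g N) (g ` {..<N}) = g ` {..N}" for g :: "nat \<Rightarrow> 'v"
    by (metis image_insert lessThan_Suc lessThan_Suc_atMost)
  have "(\<Sum>x\<in>PiE {..Suc N} (\<lambda>_. V). c * (\<Prod>j<Suc N. P (x j) (x (Suc j))) * \<psi> (x (Suc N)) (x ` {..N}))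
    = (\<Sum>(y, g)\<in>V \<times> PiE {..N} (\<lambda>_. V). c * (\<Prod>j<Suc N. P ((g(Suc N := y)) j) ((g(Suc N := y)) (Suc j)))
        * \<psi> y ((g(Suc N := y)) ` {..N}))"
    unfolding Suc PiE_insert_eq
    by (subst sum.reindex) (auto intro!: inj_combinator sum.cong simp: case_prod_beta)
  also have "\<dots> = (\<Sum>(y, g)\<in>V \<times> PiE {..N} (\<lambda>_. V). c * (\<Prod>j<N. P (g j) (g (Suc j))) * (P (g N) y * \<psi> y (g ` {..N})))"
  proof (intro sum.cong refl, clarify)
    fix y :: 'v and g :: "nat \<Rightarrow> 'v"
    have "(g(Suc N := y)) ` {..N} = g ` {..N}" by (intro image_cong) auto
    moreover have "(\<Prod>j<Suc N. P ((g(Suc N := y)) j) ((g(Suc N := y)) (Suc j)))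
        = (\<Prod>j<N. P (g j) (g (Suc j))) * P (g N) y"
      by (simp add: prod.lessThan_Suc)
    ultimately show "c * (\<Prod>j<Suc N. P ((g(Suc N := y)) j) ((g(Suc N := y)) (Suc j)))
        * \<psi> y ((g(Suc N := y)) ` {..N}) = c * (\<Prod>j<N. P (g j) (g (Suc j))) * (P (g N) y * \<psi> y (g ` {..N}))"
      by simp
  qed
  also have "\<dots> = (\<Sum>g\<in>PiE {..N} (\<lambda>_. V). \<Sum>y\<in>V. c * (\<Prod>j<N. P (g j) (g (Suc j))) * (P (g N) y * \<psi> y (g ` {..N})))"
    by (subst sum.swap) (simp add: sum.cartesian_product)
  finally show ?thesis by (simp add: ins sum_distrib_left)
qed

text \<open>Summing out the last of the \<open>N\<close> explicit steps reproduces the recursion of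
  \<open>path_mean\<close> and so turns \<open>k\<close> into \<open>Suc k\<close>. The general
  \<open>k\<close> is what makes the induction on \<open>N\<close> work.\<close>

lemma sum_paths_path_mean:
  assumes V: "finite V"
  shows "(\<Sum>x\<in>PiE {..N} (\<lambda>_. V). c * (\<Prod>j<N. P (x j) (x (Suc j))) * path_mean V P k F (x N) (x ` {..<N}))
    = (\<Sum>x\<in>V. c * path_mean V P (N + k) F x {})"
proof (induction N arbitrary: k)
  case 0
  have "(\<Sum>x\<in>PiE {..0::nat} (\<lambda>_. V). c * path_mean V P k F (x 0) {}) = (\<Sum>v\<in>V. c * path_mean V P k F v {})"
    by (intro sum.reindex_bij_witness[of _ "\<lambda>v. \<lambda>i\<in>{..0}. v" "\<lambda>x. x 0"])
      (auto simp: fun_eq_iff PiE_def extensional_def)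
  then show ?case by simp
next
  case (Suc N)
  show ?case
    using sum_paths_Suc[OF V, where N = N and c = c and P = P and \<psi> = "path_mean V P k F"] Suc.IH[of "Suc k"]
    by (simp add: lessThan_Suc_atMost)
qed

lemma sum_paths_visited:
  assumes "finite V"
  shows "(\<Sum>x\<in>PiE {..N} (\<lambda>_. V). c * (\<Prod>j<N. P (x j) (x (Suc j))) * F (x ` {..N}))
    = (\<Sum>x\<in>V. c * path_mean V P N F x {})"
proof -
  have "insert (x N) (x ` {..<N}) = x ` {..N}" for x :: "nat \<Rightarrow> 'a"
    by (metis image_insert lessThan_Suc lessThan_Suc_atMost)
  then show ?thesis using sum_paths_path_mean[OF assms, where N = N and c = c and P = P and k = 0 and F = F] by simp
qed

section \<open>The continuous-time walk and its transition probabilities\<close>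

locale gapped_walk = regular_graph d G
  for d :: nat and G :: "('v, 'e) multigraph" +
  fixes M :: "'w measure" and X :: "real \<Rightarrow> 'w \<Rightarrow> 'v" and \<alpha> :: real
  assumes walk: "stationary_walk d G M X" and gap: "spectral_gap d G \<ge> \<alpha>" and \<alpha>_pos: "\<alpha> > 0"
begin

abbreviation "n \<equiv> real (card (verts G))"

lemma n_ge_1: "1 \<le> n"
  using card_pos by simp

sublocale prob_space M
  using walk by (simp add: stationary_walk_def)

lemma X_measurable: "0 \<le> t \<Longrightarrow> X t \<in> M \<rightarrow>\<^sub>M count_space (verts G)"
  using walk by (simp add: stationary_walk_def)

lemma X_in: "\<lbrakk>0 \<le> t; \<omega> \<in> space M\<rbrakk> \<Longrightarrow> X t \<omega> \<in> verts G"
  using measurable_space[OF X_measurable] by simp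

lemma X_sets: "0 \<le> t \<Longrightarrow> {\<omega> \<in> space M. X t \<omega> = x} \<in> sets M"
  using measurable_sets[OF X_measurable, of t "{x} \<inter> verts G"] X_in[of t]
  by (auto simp: vimage_def Int_def conj_commute cong: rev_conj_cong)

lemma X_right_continuous: "\<lbrakk>0 \<le> t; \<omega> \<in> space M\<rbrakk> \<Longrightarrow> eventually (\<lambda>s. X s \<omega> = X t \<omega>) (at_right t)"
  using walk by (simp add: stationary_walk_def)

lemma fdd:
  assumes "t 0 = 0" "\<And>j. j < k \<Longrightarrow> t j \<le> t (Suc j)" "\<And>j. j \<le> k \<Longrightarrow> x j \<in> verts G"
  shows "prob {\<omega> \<in> space M. \<forall>j\<le>k. X (t j) \<omega> = x j}
    = 1 / n * (\<Prod>j<k. transition_prob d G (t (Suc j) - t j) (x j) (x (Suc j)))"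
  using walk assms unfolding stationary_walk_def by blast

lemma prob_split:
  assumes t: "0 \<le> t" and A: "{\<omega> \<in> space M. Q \<omega>} \<in> sets M"
  shows "prob {\<omega> \<in> space M. Q \<omega>} = (\<Sum>y\<in>verts G. prob {\<omega> \<in> space M. Q \<omega> \<and> X t \<omega> = y})"
proof -
  let ?B = "\<lambda>y. {\<omega> \<in> space M. Q \<omega> \<and> X t \<omega> = y}"
  have "?B y = {\<omega> \<in> space M. Q \<omega>} \<inter> {\<omega> \<in> space M. X t \<omega> = y}" for y by auto
  then have "?B ` verts G \<subseteq> sets M" using A X_sets[OF t] by auto
  then have "prob (\<Union>y\<in>verts G. ?B y) = (\<Sum>y\<in>verts G. prob (?B y))"
    using finite_verts by (intro finite_measure_finite_Union) (auto simp: disjoint_family_on_def)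
  moreover have "(\<Union>y\<in>verts G. ?B y) = {\<omega> \<in> space M. Q \<omega>}" using X_in[OF t] by auto
  ultimately show ?thesis by simp
qed

lemma prob_two_times:
  assumes "0 \<le> t" "x \<in> verts G" "y \<in> verts G"
  shows "prob {\<omega> \<in> space M. X 0 \<omega> = x \<and> X t \<omega> = y} = transition_prob d G t x y / n"
proof -
  have *: "(\<forall>j\<le>Suc 0. Q j) \<longleftrightarrow> Q 0 \<and> Q (Suc 0)" for Q by (auto simp: le_Suc_eq)
  show ?thesis
    using fdd[of "\<lambda>j. if j = 0 then 0 else t" 1 "\<lambda>j. if j = 0 then x else y"] assms
    by (simp add: * split: if_splits)
qed

lemma prob_start:
  assumes "x \<in> verts G"
  shows "prob {\<omega> \<in> space M. X 0 \<omega> = x} = 1 / n"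
  using fdd[of "\<lambda>_. 0" 0 "\<lambda>_. x"] assms by simp

lemma prob_three_times:
  assumes "0 \<le> s" "0 \<le> t" "x \<in> verts G" "y \<in> verts G" "z \<in> verts G"
  shows "prob {\<omega> \<in> space M. X 0 \<omega> = x \<and> X (s + t) \<omega> = z \<and> X s \<omega> = y}
    = transition_prob d G s x y * transition_prob d G t y z / n"
proof -
  have *: "(\<forall>j\<le>Suc (Suc 0). Q j) \<longleftrightarrow> Q 0 \<and> Q (Suc (Suc 0)) \<and> Q (Suc 0)" for Q by (auto simp: le_Suc_eq)
  show ?thesis
    using fdd[of "\<lambda>j. if j = 0 then 0 else if j = 1 then s else s + t" "Suc (Suc 0)"
        "\<lambda>j. if j = 0 then x else if j = 1 then y else z"] assms
    by (simp add: * split: if_splits)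
qed

text \<open>Nonnegativity, unit row sums and the Chapman-Kolmogorov equation are read off from the
  laws of the walk at one, two and three times, where the entries appear as probabilities. Only
  holding and mixing need the analysis of the semigroup.\<close>

sublocale mixing_kernel "verts G" "transition_prob d G" \<alpha>
proof
  have n: "0 < n" using card_pos by simp
  show nn: "0 \<le> transition_prob d G t x y" if "0 \<le> t" "x \<in> verts G" "y \<in> verts G" for t x y
  proof -
    have "0 \<le> transition_prob d G t x y / n" using prob_two_times[OF that] measure_nonneg by metis
    then show ?thesis using n by (simp add: zero_le_divide_iff)
  qed
  show "(\<Sum>y\<in>verts G. transition_prob d G t x y) = 1" if "0 \<le> t" "x \<in> verts G" for t x
  proof -
    have "1 / n = (\<Sum>y\<in>verts G. transition_prob d G t x y / n)"
      using prob_split[OF that(1) X_sets[of 0 x]] that by (simp add: prob_start prob_two_times)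
    then show ?thesis using n by (simp flip: sum_divide_distrib)
  qed
  show "transition_prob d G (s + t) x z = (\<Sum>y\<in>verts G. transition_prob d G s x y * transition_prob d G t y z)"
    if "0 \<le> s" "0 \<le> t" "x \<in> verts G" "z \<in> verts G" for s t x z
  proof -
    have "{\<omega> \<in> space M. X 0 \<omega> = x \<and> X (s + t) \<omega> = z} \<in> sets M"
      using X_sets[of 0 x] X_sets[of "s + t" z] that by (intro sets.sets_Collect_conj) auto
    from prob_split[OF that(1) this]
    have "transition_prob d G (s + t) x z / n
        = (\<Sum>y\<in>verts G. transition_prob d G s x y * transition_prob d G t y z / n)"
      using that by (simp add: prob_two_times prob_three_times)
    then show ?thesis using n by (simp flip: sum_divide_distrib)
  qed
  show "1 - t \<le> transition_prob d G t x x" if "0 \<le> t" "x \<in> verts G" for t x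
    using transition_prob_holding[of x t] nn that by blast
  show "\<bar>transition_prob d G t x y - 1 / n\<bar> \<le> exp (- \<alpha> * t)"
    if "0 \<le> t" "x \<in> verts G" "y \<in> verts G" for t x y
    using transition_prob_mixing[OF gap that] .
qed (use finite_verts verts_nonempty \<alpha>_pos in auto)

section \<open>The walk observed on a time grid\<close>

definition grid_range :: "real \<Rightarrow> nat \<Rightarrow> 'w \<Rightarrow> 'v set" where
  "grid_range \<delta> N \<omega> = (\<lambda>j. X (real j * \<delta>) \<omega>) ` {..N}"

definition path_range :: "real \<Rightarrow> 'w \<Rightarrow> 'v set" where
  "path_range T \<omega> = (\<lambda>t. X t \<omega>) ` {0..T}"

text \<open>Exactly one path of the finite path space agrees with the walk on the grid. The
  resulting finite sum of indicators gives both measurability and the expectation.\<close>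

lemma grid_range_expand:
  assumes \<delta>: "0 \<le> \<delta>" and \<omega>: "\<omega> \<in> space M"
  shows "\<Phi> (grid_range \<delta> N \<omega>) = (\<Sum>x\<in>PiE {..N} (\<lambda>_. verts G).
    \<Phi> (x ` {..N}) * indicator {\<omega> \<in> space M. \<forall>j\<le>N. X (real j * \<delta>) \<omega> = x j} \<omega> :: real)"
proof -
  let ?x = "\<lambda>j\<in>{..N}. X (real j * \<delta>) \<omega>"
  have mem: "?x \<in> PiE {..N} (\<lambda>_. verts G)" using X_in \<delta> \<omega> by auto
  have img: "?x ` {..N} = grid_range \<delta> N \<omega>" by (simp add: grid_range_def)
  have "indicator {\<omega> \<in> space M. \<forall>j\<le>N. X (real j * \<delta>) \<omega> = x j} \<omega> = (if x = ?x then 1 else 0 :: real)"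
    if "x \<in> PiE {..N} (\<lambda>_. verts G)" for x
    using that \<omega> by (fastforce simp: indicator_def PiE_iff extensional_def)
  then have "(\<Sum>x\<in>PiE {..N} (\<lambda>_. verts G).
    \<Phi> (x ` {..N}) * indicator {\<omega> \<in> space M. \<forall>j\<le>N. X (real j * \<delta>) \<omega> = x j} \<omega>)
    = (\<Sum>x\<in>PiE {..N} (\<lambda>_. verts G). if x = ?x then \<Phi> (x ` {..N}) else 0)"
    by (intro sum.cong) auto
  also have "\<dots> = \<Phi> (grid_range \<delta> N \<omega>)"
    using mem finite_PiE[of "{..N}" "\<lambda>_. verts G"] finite_verts by (simp add: grid_range_def)
  finally show ?thesis by simp
qed

lemma grid_sets:
  assumes "0 \<le> \<delta>"
  shows "{\<omega> \<in> space M. \<forall>j\<le>N. X (real j * \<delta>) \<omega> = x j} \<in> sets M"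
proof -
  have "{\<omega> \<in> space M. X (real j * \<delta>) \<omega> = x j} \<in> sets M" for j
    using assms by (intro X_sets) simp
  then have "{\<omega> \<in> space M. \<forall>j\<in>{..N}. X (real j * \<delta>) \<omega> = x j} \<in> sets M"
    by (rule sets.sets_Collect_finite_All) simp
  moreover have "{\<omega> \<in> space M. \<forall>j\<in>{..N}. X (real j * \<delta>) \<omega> = x j} = {\<omega> \<in> space M. \<forall>j\<le>N. X (real j * \<delta>) \<omega> = x j}"
    by auto
  ultimately show ?thesis by (simp only:)
qed

lemma grid_range_measurable:
  fixes \<Phi> :: "'v set \<Rightarrow> real"
  assumes "0 \<le> \<delta>"
  shows "(\<lambda>\<omega>. \<Phi> (grid_range \<delta> N \<omega>)) \<in> borel_measurable M"
proof -
  have "(\<lambda>\<omega>. \<Sum>x\<in>PiE {..N} (\<lambda>_. verts G). \<Phi> (x ` {..N})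
      * indicator {\<omega> \<in> space M. \<forall>j\<le>N. X (real j * \<delta>) \<omega> = x j} \<omega>) \<in> borel_measurable M"
    by (intro borel_measurable_sum borel_measurable_times borel_measurable_const
        borel_measurable_indicator grid_sets[OF assms])
  then show ?thesis
    by (rule measurable_cong[THEN iffD2, rotated])
      (rule grid_range_expand[OF assms, where \<Phi> = \<Phi> and N = N])
qed

lemma expectation_grid_range:
  fixes \<Phi> :: "'v set \<Rightarrow> real"
  assumes "0 \<le> \<delta>"
  shows "expectation (\<lambda>\<omega>. \<Phi> (grid_range \<delta> N \<omega>)) = stationary_mean \<delta> N \<Phi>"
proof -
  let ?A = "\<lambda>x. {\<omega> \<in> space M. \<forall>j\<le>N. X (real j * \<delta>) \<omega> = x j}"
  have "expectation (\<lambda>\<omega>. \<Phi> (grid_range \<delta> N \<omega>))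
      = expectation (\<lambda>\<omega>. \<Sum>x\<in>PiE {..N} (\<lambda>_. verts G). \<Phi> (x ` {..N}) * indicator (?A x) \<omega>)"
    by (rule Bochner_Integration.integral_cong[OF refl])
      (rule grid_range_expand[OF assms, where \<Phi> = \<Phi> and N = N])
  also have "\<dots> = (\<Sum>x\<in>PiE {..N} (\<lambda>_. verts G). \<Phi> (x ` {..N}) * prob (?A x))"
  proof -
    have fin: "emeasure M A < \<infinity>" for A
      using emeasure_finite[of A] unfolding infinity_ennreal_def less_top .
    have int: "integrable M (\<lambda>\<omega>. \<Phi> (x ` {..N}) * indicator (?A x) \<omega>)" for x
      by (rule integrable_mult_right, rule integrable_real_indicator, rule grid_sets[OF assms])
        (rule fin)
    have "expectation (\<lambda>\<omega>. \<Phi> (x ` {..N}) * indicator (?A x) \<omega>) = \<Phi> (x ` {..N}) * prob (?A x)" for x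
    proof -
      have "?A x \<inter> space M = ?A x" by (rule Int_absorb2) (rule Collect_restrict)
      then show ?thesis by (simp only: integral_mult_right_zero Bochner_Integration.integral_indicator)
    qed
    note E = this
    have "expectation (\<lambda>\<omega>. \<Sum>x\<in>PiE {..N} (\<lambda>_. verts G). \<Phi> (x ` {..N}) * indicator (?A x) \<omega>)
      = (\<Sum>x\<in>PiE {..N} (\<lambda>_. verts G). expectation (\<lambda>\<omega>. \<Phi> (x ` {..N}) * indicator (?A x) \<omega>))"
      by (rule Bochner_Integration.integral_sum[where I = "PiE {..N} (\<lambda>_. verts G)"
            and f = "\<lambda>x \<omega>. \<Phi> (x ` {..N}) * indicator (?A x) \<omega>"]) (rule int)
    then show ?thesis by (simp only: E)
  qed
  also have "\<dots> = (\<Sum>x\<in>PiE {..N} (\<lambda>_. verts G). 1 / n * (\<Prod>j<N. transition_prob d G \<delta> (x j) (x (Suc j))) * \<Phi> (x ` {..N}))"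
  proof (intro sum.cong refl)
    fix x assume "x \<in> PiE {..N} (\<lambda>_. verts G)"
    then have x: "x j \<in> verts G" if "j \<le> N" for j using that by auto
    have "real j * \<delta> \<le> real (Suc j) * \<delta>" for j using assms by (intro mult_right_mono) auto
    moreover have "real (Suc j) * \<delta> - real j * \<delta> = \<delta>" for j by (simp add: algebra_simps)
    ultimately have "prob (?A x) = 1 / n * (\<Prod>j<N. transition_prob d G \<delta> (x j) (x (Suc j)))"
      using fdd[of "\<lambda>j. real j * \<delta>" N x] x by (simp del: of_nat_Suc)
    then show "\<Phi> (x ` {..N}) * prob (?A x)
      = 1 / n * (\<Prod>j<N. transition_prob d G \<delta> (x j) (x (Suc j))) * \<Phi> (x ` {..N})" by simp
  qed
  also have "\<dots> = (\<Sum>x\<in>verts G. 1 / n * path_mean (verts G) (transition_prob d G \<delta>) N \<Phi> x {})"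
    by (rule sum_paths_visited[OF finite_verts, where N = N and c = "1 / n"
        and P = "transition_prob d G \<delta>" and F = \<Phi>])
  finally show ?thesis by (simp only: stationary_mean_def)
qed

end

text \<open>With \<open>\<theta> = 2 / sqrt x\<close> and \<open>B = a + b * ln x\<close>, these are
  the three demands of the final estimate: \<open>\<theta> * B \<le> 1\<close>, a threshold of at
  least 4, and an error exponent up to the cover time of at most half the gain.\<close>

lemma log_factors_negligible:
  fixes a b c \<epsilon> :: real
  assumes "a > 0" "b > 0" "c > 0" "\<epsilon> > 0"
  shows "eventually (\<lambda>x. 2 * (a + b * ln x) \<le> sqrt x \<and> 4 \<le> x powr (1 / 2 + \<epsilon>) \<and>
    (2 / sqrt x)\<^sup>2 * (a + b * ln x)\<^sup>2 * (1 + (2 * x * ln x + 1) * (ln (2 * x) * c)) \<le> x powr \<epsilon> / 2) at_top"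
proof (intro eventually_conj)
  show "eventually (\<lambda>x. 2 * (a + b * ln x) \<le> sqrt x) at_top" using assms by real_asymp
  show "eventually (\<lambda>x. 4 \<le> x powr (1 / 2 + \<epsilon>)) at_top" using assms by real_asymp
  show "eventually (\<lambda>x. (2 / sqrt x)\<^sup>2 * (a + b * ln x)\<^sup>2 * (1 + (2 * x * ln x + 1) * (ln (2 * x) * c))
     \<le> x powr \<epsilon> / 2) at_top"
    using assms by real_asymp
qed

section \<open>From the grid to continuous time\<close>

context gapped_walk begin

lemma path_range_subset: "\<omega> \<in> space M \<Longrightarrow> path_range T \<omega> \<subseteq> verts G"
  using X_in by (auto simp: path_range_def)

lemma path_range_mono: "S \<le> T \<Longrightarrow> path_range S \<omega> \<subseteq> path_range T \<omega>"
  by (auto simp: path_range_def)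

lemma grid_range_subset_path_range:
  assumes "0 \<le> \<delta>" "real N * \<delta> \<le> T"
  shows "grid_range \<delta> N \<omega> \<subseteq> path_range T \<omega>"
proof -
  have "real j * \<delta> \<le> T" if "j \<le> N" for j
    using mult_right_mono[of "real j" "real N" \<delta>] assms that by simp
  then show ?thesis using assms(1) unfolding grid_range_def path_range_def by force
qed

text \<open>By right-continuity a visited state is kept for a while, so a fine grid meets it. The
  end time \<open>T\<close> needs separate care, as the walk may jump there and leave no room to the
  right; it is the last point of every grid used.\<close>

lemma eventually_in_grid_range:
  assumes T: "0 \<le> T" and \<omega>: "\<omega> \<in> space M" and y: "y \<in> path_range T \<omega>"
  shows "eventually (\<lambda>N. y \<in> grid_range (T / real (Suc N)) (Suc N) \<omega>) sequentially"
proof -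
  obtain t where t: "0 \<le> t" "t \<le> T" "y = X t \<omega>" using y by (auto simp: path_range_def)
  show ?thesis
  proof (cases "t = T")
    case True
    have "y \<in> grid_range (T / real (Suc N)) (Suc N) \<omega>" for N
      unfolding grid_range_def using True t(3)
      by (intro image_eqI[where x = "Suc N"]) (simp_all del: of_nat_Suc)
    then show ?thesis by simp
  next
    case False
    with t have tT: "t < T" by simp
    obtain b where b: "t < b" "\<And>s. \<lbrakk>t < s; s < b\<rbrakk> \<Longrightarrow> X s \<omega> = X t \<omega>"
      using X_right_continuous[OF t(1) \<omega>] unfolding eventually_at_right_field by blast
    have "((\<lambda>N. T / real (Suc N)) \<longlongrightarrow> 0) sequentially" by real_asymp
    then have "eventually (\<lambda>N. T / real (Suc N) < b - t) sequentially"
      using b(1) by (intro order_tendstoD) auto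
    then show ?thesis
    proof eventually_elim
      case (elim N)
      define m where "m = real (Suc N)"
      \<comment> \<open>This is the index of the first grid point strictly after
        \<open>t\<close>.\<close>
      define j where "j = Suc (nat \<lfloor>t * m / T\<rfloor>)"
      have m: "0 < m" and mT: "T / m < b - t" using elim by (auto simp: m_def)
      have T0: "0 < T" using t tT by simp
      have j: "real j > t * m / T" "real j \<le> t * m / T + 1"
        using t T0 m by (auto simp: j_def) linarith
      have "t * m / T < m" using tT T0 m by (simp add: field_simps)
      then have "real j < real (Suc (Suc N))" using j(2) by (simp add: m_def)
      then have jN: "j \<le> Suc N" by simp
      have lower: "t < real j * (T / m)" using j(1) T0 m by (simp add: field_simps)
      have "real j * (T / m) \<le> (t * m / T + 1) * (T / m)"
        using j(2) T0 m by (intro mult_right_mono) auto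
      also have "\<dots> = t + T / m" using T0 m by (simp add: field_simps)
      finally have "real j * (T / m) < b" using mT by simp
      then have "X (real j * (T / m)) \<omega> = y" using b(2)[OF lower] t(3) by simp
      then show ?case
        unfolding grid_range_def m_def using jN by (intro image_eqI[where x = j]) auto
    qed
  qed
qed

lemma eventually_grid_range:
  assumes T: "0 \<le> T" and \<omega>: "\<omega> \<in> space M"
  shows "eventually (\<lambda>N. grid_range (T / real (Suc N)) (Suc N) \<omega> = path_range T \<omega>) sequentially"
proof -
  have "finite (path_range T \<omega>)"
    by (rule finite_subset[OF path_range_subset[OF \<omega>] finite_verts])
  then have "eventually (\<lambda>N. \<forall>y\<in>path_range T \<omega>. y \<in> grid_range (T / real (Suc N)) (Suc N) \<omega>) sequentially"
    by (rule eventually_ball_finite) (use eventually_in_grid_range[OF T \<omega>] in blast)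
  then show ?thesis
  proof eventually_elim
    case (elim N)
    have "grid_range (T / real (Suc N)) (Suc N) \<omega> \<subseteq> path_range T \<omega>"
      using T by (intro grid_range_subset_path_range) (simp_all del: of_nat_Suc)
    then show ?case using elim by blast
  qed
qed

text \<open>For each outcome the grid range equals the full range from some mesh on, so every
  functional converges pointwise. It takes finitely many values on subsets of the vertices, which
  provides the constant for dominated convergence.\<close>

lemma
  fixes \<Phi> :: "'v set \<Rightarrow> real"
  assumes T: "0 \<le> T"
  shows path_range_measurable: "(\<lambda>\<omega>. \<Phi> (path_range T \<omega>)) \<in> borel_measurable M"
    and stationary_mean_tendsto: "(\<lambda>N. stationary_mean (T / real (Suc N)) (Suc N) \<Phi>)
      \<longlonglongrightarrow> expectation (\<lambda>\<omega>. \<Phi> (path_range T \<omega>))"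
    and path_range_integrable: "integrable M (\<lambda>\<omega>. \<Phi> (path_range T \<omega>))"
proof -
  let ?u = "\<lambda>N \<omega>. \<Phi> (grid_range (T / real (Suc N)) (Suc N) \<omega>)"
  have \<delta>: "0 \<le> T / real (Suc N)" for N using T by simp
  have conv: "(\<lambda>N. ?u N \<omega>) \<longlonglongrightarrow> \<Phi> (path_range T \<omega>)" if "\<omega> \<in> space M" for \<omega>
    by (rule tendsto_eventually, rule eventually_mono[OF eventually_grid_range[OF T that]]) simp
  have u: "?u N \<in> borel_measurable M" for N by (rule grid_range_measurable[OF \<delta>])
  show meas: "(\<lambda>\<omega>. \<Phi> (path_range T \<omega>)) \<in> borel_measurable M"
    by (rule borel_measurable_LIMSEQ_real[OF conv u])
  define C where "C = Max ((\<lambda>S. \<bar>\<Phi> S\<bar>) ` Pow (verts G))"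
  have C: "norm (\<Phi> S) \<le> C" if "S \<subseteq> verts G" for S
    unfolding C_def real_norm_def using finite_verts that by (intro Max_ge) auto
  have grid: "grid_range (T / real (Suc N)) (Suc N) \<omega> \<subseteq> verts G" if "\<omega> \<in> space M" for N \<omega>
    unfolding grid_range_def using X_in[OF _ that] T by (auto simp del: of_nat_Suc)
  have "(\<lambda>N. expectation (?u N)) \<longlonglongrightarrow> expectation (\<lambda>\<omega>. \<Phi> (path_range T \<omega>))"
  proof (rule integral_dominated_convergence[where w = "\<lambda>_. C"])
    show "AE \<omega> in M. (\<lambda>N. ?u N \<omega>) \<longlonglongrightarrow> \<Phi> (path_range T \<omega>)" by (rule AE_I2) (rule conv)
    show "AE \<omega> in M. norm (?u N \<omega>) \<le> C" for N by (rule AE_I2) (rule C[OF grid])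
  qed (use meas u in auto)
  then show "(\<lambda>N. stationary_mean (T / real (Suc N)) (Suc N) \<Phi>)
      \<longlonglongrightarrow> expectation (\<lambda>\<omega>. \<Phi> (path_range T \<omega>))"
    by (simp only: expectation_grid_range[OF \<delta>])
  show "integrable M (\<lambda>\<omega>. \<Phi> (path_range T \<omega>))"
    by (rule integrable_const_bound[OF AE_I2 meas]) (rule C[OF path_range_subset])
qed

text \<open>The discrete bound is independent of the mesh: \<open>Suc N\<close> steps of length
  \<open>T / Suc N\<close> last exactly \<open>T\<close>. It therefore passes to the limit, where
  large \<open>N\<close> ensures that the mesh is at most 1.\<close>

lemma expectation_exp_le:
  assumes T: "0 \<le> T" and L: "\<And>z R. \<bar>F (insert z R) - F R\<bar> \<le> L"
    and F: "\<And>R. \<bar>F R\<bar> \<le> n"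
    and B: "B = 2 * L * (4 + 2 * ln n / \<alpha>) + 2" and \<theta>: "\<bar>\<theta>\<bar> * B \<le> 1"
  shows "expectation (\<lambda>\<omega>. exp (\<theta> * F (path_range T \<omega>)))
    \<le> exp (\<theta> * expectation (\<lambda>\<omega>. F (path_range T \<omega>)) + \<theta>\<^sup>2 * B\<^sup>2 * (1 + T))"
proof (rule LIMSEQ_le)
  let ?m = "\<lambda>N. stationary_mean (T / real (Suc N)) (Suc N)"
  show "(\<lambda>N. ?m N (\<lambda>R. exp (\<theta> * F R))) \<longlonglongrightarrow> expectation (\<lambda>\<omega>. exp (\<theta> * F (path_range T \<omega>)))"
    by (rule stationary_mean_tendsto[OF T])
  show "(\<lambda>N. exp (\<theta> * ?m N F + \<theta>\<^sup>2 * B\<^sup>2 * (1 + T)))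
      \<longlonglongrightarrow> exp (\<theta> * expectation (\<lambda>\<omega>. F (path_range T \<omega>)) + \<theta>\<^sup>2 * B\<^sup>2 * (1 + T))"
    by (intro tendsto_intros stationary_mean_tendsto[OF T])
  obtain N0 where N0: "T \<le> real N0" using real_arch_simple by blast
  have "?m N (\<lambda>R. exp (\<theta> * F R)) \<le> exp (\<theta> * ?m N F + \<theta>\<^sup>2 * B\<^sup>2 * (1 + T))" if "N0 \<le> N" for N
  proof -
    have pos: "0 < real (Suc N)" by simp
    have "T \<le> real (Suc N)" using N0 that by simp
    then have "T / real (Suc N) \<le> 1" using pos by (simp del: of_nat_Suc)
    moreover have "0 \<le> T / real (Suc N)" using T by simp
    moreover have "real (Suc N) * (T / real (Suc N)) = T" using pos by (simp del: of_nat_Suc)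
    ultimately show ?thesis using stationary_mean_exp_le[OF _ _ L F B \<theta>] by metis
  qed
  then show "\<exists>N0. \<forall>N\<ge>N0. ?m N (\<lambda>R. exp (\<theta> * F R)) \<le> exp (\<theta> * ?m N F + \<theta>\<^sup>2 * B\<^sup>2 * (1 + T))"
    by blast
qed

section \<open>Concentration for the continuous-time walk\<close>

lemma concentration:
  assumes T: "0 \<le> T" and L: "\<And>z R. \<bar>F (insert z R) - F R\<bar> \<le> L"
    and F: "\<And>R. \<bar>F R\<bar> \<le> n"
    and B: "B = 2 * L * (4 + 2 * ln n / \<alpha>) + 2" and \<theta>: "0 < \<theta>" "\<theta> * B \<le> 1"
  shows "prob {\<omega> \<in> space M. \<bar>F (path_range T \<omega>) - expectation (\<lambda>\<omega>. F (path_range T \<omega>))\<bar> \<ge> r}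
    \<le> 2 * exp (- \<theta> * r + \<theta>\<^sup>2 * B\<^sup>2 * (1 + T))"
proof -
  define \<mu> where "\<mu> = expectation (\<lambda>\<omega>. F (path_range T \<omega>))"
  have tail: "prob {\<omega> \<in> space M. exp (s * (F (path_range T \<omega>) - \<mu>)) \<ge> exp (\<theta> * r)}
      \<le> exp (- \<theta> * r + \<theta>\<^sup>2 * B\<^sup>2 * (1 + T))" if s: "\<bar>s\<bar> = \<theta>" for s
  proof -
    have s2: "s\<^sup>2 = \<theta>\<^sup>2" using s by (metis power2_abs)
    have split: "exp (s * (x - \<mu>)) = exp (- (s * \<mu>)) * exp (s * x)" for x
      by (simp add: right_diff_distrib flip: exp_add)
    have "prob {\<omega> \<in> space M. exp (s * (F (path_range T \<omega>) - \<mu>)) \<ge> exp (\<theta> * r)}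
        \<le> expectation (\<lambda>\<omega>. exp (s * (F (path_range T \<omega>) - \<mu>))) / exp (\<theta> * r)"
      by (rule integral_Markov_inequality_measure[where A = "space M"])
        (use path_range_integrable[OF T, of "\<lambda>R. exp (s * (F R - \<mu>))"] in auto)
    also have "\<dots> = exp (- (s * \<mu>)) * expectation (\<lambda>\<omega>. exp (s * F (path_range T \<omega>))) / exp (\<theta> * r)"
      by (simp only: split integral_mult_right_zero)
    also have "\<dots> \<le> exp (- (s * \<mu>)) * exp (s * \<mu> + \<theta>\<^sup>2 * B\<^sup>2 * (1 + T)) / exp (\<theta> * r)"
      using expectation_exp_le[OF T L F B, of s] s \<theta> unfolding \<mu>_def[symmetric] s2
      by (intro divide_right_mono mult_left_mono) auto
    also have "\<dots> = exp (- \<theta> * r + \<theta>\<^sup>2 * B\<^sup>2 * (1 + T))"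
      by (simp add: exp_diff[symmetric] exp_add[symmetric])
    finally show ?thesis .
  qed
  let ?E = "\<lambda>s. {\<omega> \<in> space M. exp (s * (F (path_range T \<omega>) - \<mu>)) \<ge> exp (\<theta> * r)}"
  have sets: "?E s \<in> sets M" for s
    by (rule borel_measurable_le[OF borel_measurable_const
          path_range_measurable[OF T, of "\<lambda>R. exp (s * (F R - \<mu>))"]])
  have "{\<omega> \<in> space M. \<bar>F (path_range T \<omega>) - \<mu>\<bar> \<ge> r} \<subseteq> ?E \<theta> \<union> ?E (- \<theta>)"
  proof
    fix \<omega> assume "\<omega> \<in> {\<omega> \<in> space M. \<bar>F (path_range T \<omega>) - \<mu>\<bar> \<ge> r}"
    then have \<omega>: "\<omega> \<in> space M" and "r \<le> F (path_range T \<omega>) - \<mu> \<or> r \<le> - (F (path_range T \<omega>) - \<mu>)"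
      by auto
    then have "\<theta> * r \<le> \<theta> * (F (path_range T \<omega>) - \<mu>) \<or> \<theta> * r \<le> \<theta> * - (F (path_range T \<omega>) - \<mu>)"
      using \<theta>(1) by (metis mult_le_cancel_left_pos)
    then show "\<omega> \<in> ?E \<theta> \<union> ?E (- \<theta>)" using \<omega> by (simp add: algebra_simps)
  qed
  then have "prob {\<omega> \<in> space M. \<bar>F (path_range T \<omega>) - \<mu>\<bar> \<ge> r} \<le> prob (?E \<theta> \<union> ?E (- \<theta>))"
    by (rule finite_measure_mono) (intro sets.Un sets)
  also have "\<dots> \<le> prob (?E \<theta>) + prob (?E (- \<theta>))"
    by (rule measure_Un_le[OF sets sets])
  also have "\<dots> \<le> 2 * exp (- \<theta> * r + \<theta>\<^sup>2 * B\<^sup>2 * (1 + T))"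
    using tail[of \<theta>] tail[of "- \<theta>"] \<theta>(1) by simp
  finally show ?thesis unfolding \<mu>_def .
qed

text \<open>A step of length \<open>ln (2 * n) / \<alpha>\<close> hits each vertex with probability
  at least \<open>1 / (2 * n)\<close>, and about \<open>2 * n * ln n\<close> steps leave at most one
  vertex unvisited on average. The added 1 pays for rounding the number of steps up.\<close>

definition cover_time :: real where
  "cover_time = (2 * n * ln n + 1) * (ln (2 * n) / \<alpha>)"

lemma cover_time_nonneg: "0 \<le> cover_time"
  using n_ge_1 \<alpha>_pos by (simp add: cover_time_def)

text \<open>The walk is observed only on a coarse grid with mixing-length steps. This can only
  enlarge the vacant set, and \<open>stationary_mean_vacant_le\<close> applies to the grid.\<close>

lemma expectation_vacant_le:
  assumes T: "cover_time \<le> T"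
  shows "expectation (\<lambda>\<omega>. real (card (verts G - path_range T \<omega>))) \<le> 1"
proof -
  define \<tau> where "\<tau> = ln (2 * n) / \<alpha>"
  define J where "J = nat \<lceil>2 * n * ln n\<rceil>"
  have n0: "0 \<le> 2 * n * ln n" using n_ge_1 by simp
  have J: "2 * n * ln n \<le> real J" "real J \<le> 2 * n * ln n + 1" using n0 by (auto simp: J_def)
  have \<tau>: "0 \<le> \<tau>" using n_ge_1 \<alpha>_pos by (simp add: \<tau>_def)
  have T0: "0 \<le> T" using cover_time_nonneg T by linarith
  have "real J * \<tau> \<le> T"
    using mult_right_mono[OF J(2) \<tau>] T by (simp add: cover_time_def \<tau>_def)
  then have sub: "grid_range \<tau> J \<omega> \<subseteq> path_range T \<omega>" for \<omega> by (rule grid_range_subset_path_range[OF \<tau>])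
  let ?H = "\<lambda>R. real (card (verts G - R))"
  have int: "integrable M (\<lambda>\<omega>. ?H (grid_range \<tau> J \<omega>))"
    by (rule integrable_const_bound[OF AE_I2 grid_range_measurable[OF \<tau>], where B = n])
      (use finite_verts in \<open>auto intro!: card_mono\<close>)
  have "expectation (\<lambda>\<omega>. ?H (path_range T \<omega>)) \<le> expectation (\<lambda>\<omega>. ?H (grid_range \<tau> J \<omega>))"
    using sub finite_verts by (intro integral_mono[OF path_range_integrable[OF T0] int]) (auto intro!: card_mono)
  also have "\<dots> \<le> 1"
    unfolding expectation_grid_range[OF \<tau>, of ?H] using J(1) by (intro stationary_mean_vacant_le) (simp_all add: \<tau>_def)
  finally show ?thesis .
qed

lemma card_vacant_insert_le:
  "\<bar>real (card (verts G - insert z R)) - real (card (verts G - R))\<bar> \<le> 1"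
proof -
  have eq: "verts G - insert z R = (verts G - R) - {z}" by auto
  show ?thesis unfolding eq using finite_verts by (cases "z \<in> verts G - R") (auto simp: card_Diff_singleton_if)
qed

text \<open>\<open>T\<close> may be arbitrarily large, but the bound involves only the cover time.
  Beyond it, a large deviation forces many vacant sites at time \<open>T\<close>, hence at the cover
  time, where their number is concentrated. This second case is responsible for
  \<open>r / 2\<close>.\<close>

lemma degree_count_deviation:
  assumes T: "0 \<le> T"
    and B: "B = 2 * (2 * real d + 1) * (4 + 2 * ln n / \<alpha>) + 2"
    and \<theta>: "0 < \<theta>" "\<theta> * B \<le> 1" and r: "4 \<le> r"
  shows "prob {\<omega> \<in> space M. \<bar>degree_count i (path_range T \<omega>) -
      expectation (\<lambda>\<omega>. degree_count i (path_range T \<omega>))\<bar> \<ge> r}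
    \<le> 2 * exp (- \<theta> * (r / 2) + \<theta>\<^sup>2 * B\<^sup>2 * (1 + cover_time))" (is "prob ?E \<le> ?b")
proof (cases "T \<le> cover_time")
  case True
  have "prob ?E \<le> 2 * exp (- \<theta> * r + \<theta>\<^sup>2 * B\<^sup>2 * (1 + T))"
    by (rule concentration[OF T degree_count_insert_le degree_count_bound B \<theta>])
  also have "\<dots> \<le> ?b"
  proof -
    have "\<theta> * (r / 2) \<le> \<theta> * r" using \<theta> r by (intro mult_left_mono) auto
    moreover have "\<theta>\<^sup>2 * B\<^sup>2 * (1 + T) \<le> \<theta>\<^sup>2 * B\<^sup>2 * (1 + cover_time)"
      using True by (intro mult_left_mono) auto
    ultimately show ?thesis by simp
  qed
  finally show ?thesis .
next
  case False
  then have T2: "cover_time \<le> T" by simp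
  let ?H = "\<lambda>R. real (card (verts G - R))"
  let ?F = "degree_count i"
  define c where "c = (if i = 0 then n else 0)"
  have near: "\<bar>?F R - c\<bar> \<le> ?H R" for R
    using degree_count_near[of i R] by (simp add: c_def)
  define \<mu> where "\<mu> = expectation (\<lambda>\<omega>. ?H (path_range cover_time \<omega>))"
  have \<mu>: "\<mu> \<le> 1" unfolding \<mu>_def by (rule expectation_vacant_le) simp
  have EF: "\<bar>expectation (\<lambda>\<omega>. ?F (path_range T \<omega>)) - c\<bar> \<le> 1"
  proof -
    have "expectation (\<lambda>\<omega>. ?F (path_range T \<omega>)) - c = expectation (\<lambda>\<omega>. ?F (path_range T \<omega>) - c)"
      using path_range_integrable[OF T, of ?F] by (simp add: prob_space)
    also have "\<bar>\<dots>\<bar> \<le> expectation (\<lambda>\<omega>. \<bar>?F (path_range T \<omega>) - c\<bar>)" by (rule integral_abs_bound)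
    also have "\<dots> \<le> expectation (\<lambda>\<omega>. ?H (path_range T \<omega>))"
      by (rule integral_mono[OF path_range_integrable[OF T, of "\<lambda>R. \<bar>?F R - c\<bar>"] path_range_integrable[OF T]])
        (rule near)
    also have "\<dots> \<le> 1" by (rule expectation_vacant_le[OF T2])
    finally show ?thesis .
  qed
  have "?E \<subseteq> {\<omega> \<in> space M. \<bar>?H (path_range cover_time \<omega>) - \<mu>\<bar> \<ge> r / 2}"
  proof
    fix \<omega> assume "\<omega> \<in> ?E"
    then have \<omega>: "\<omega> \<in> space M" and dev: "r \<le> \<bar>?F (path_range T \<omega>) - expectation (\<lambda>\<omega>. ?F (path_range T \<omega>))\<bar>"
      by auto
    have "?H (path_range T \<omega>) \<le> ?H (path_range cover_time \<omega>)"
      using path_range_mono[OF T2, of \<omega>] finite_verts by (auto intro!: card_mono)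
    \<comment> \<open>The count and its mean lie within the vacant number and within 1 of
      \<open>c\<close>, so the vacant number is at least \<open>r - 1\<close>. Subtracting
      \<open>\<mu> \<le> 1\<close> leaves \<open>r - 2\<close>, which is at least
      \<open>r / 2\<close> since \<open>4 \<le> r\<close>.\<close>
    then have "r / 2 \<le> ?H (path_range cover_time \<omega>) - \<mu>"
      using near[of "path_range T \<omega>"] EF dev \<mu> r by linarith
    then have "r / 2 \<le> \<bar>?H (path_range cover_time \<omega>) - \<mu>\<bar>" by linarith
    with \<omega> show "\<omega> \<in> {\<omega> \<in> space M. \<bar>?H (path_range cover_time \<omega>) - \<mu>\<bar> \<ge> r / 2}" by (intro CollectI conjI)
  qed
  moreover have "{\<omega> \<in> space M. \<bar>?H (path_range cover_time \<omega>) - \<mu>\<bar> \<ge> r / 2} \<in> sets M"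
    by (rule borel_measurable_le[OF borel_measurable_const
          path_range_measurable[OF cover_time_nonneg, of "\<lambda>R. \<bar>?H R - \<mu>\<bar>"]])
  ultimately have "prob ?E \<le> prob {\<omega> \<in> space M. \<bar>?H (path_range cover_time \<omega>) - \<mu>\<bar> \<ge> r / 2}"
    by (rule finite_measure_mono)
  also have "\<dots> \<le> ?b"
    unfolding \<mu>_def
  proof (rule concentration[OF cover_time_nonneg _ _ B \<theta>])
    show "\<bar>?H (insert z R) - ?H R\<bar> \<le> 2 * real d + 1" for z R
      using card_vacant_insert_le[of z R] by linarith
    show "\<bar>?H R\<bar> \<le> n" for R using finite_verts by (auto intro!: card_mono)
  qed
  finally show ?thesis .
qed

lemma degree_count_vacant:
  "real (num_degree G (vacant_degree G X u \<omega>) i) = degree_count i (path_range (u * n) \<omega>)"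
proof -
  have "{X t \<omega> |t. 0 \<le> t \<and> t \<le> u * n} = path_range (u * n) \<omega>" by (auto simp: path_range_def)
  then show ?thesis by (simp add: degree_count_def vacant_degree_def vacant_set_def)
qed

end

theorem theorem5p2:
  "\<forall>d::nat. \<exists>c>0::real. \<forall>\<alpha>>0::real. \<forall>\<epsilon>\<in>{0<..<1/4::real}. \<exists>c\<^sub>\<epsilon>>0::real.
     \<forall>(G :: ('v, 'e) multigraph) (M :: 'w measure) (X :: real \<Rightarrow> 'w \<Rightarrow> 'v) (u::real).
       regular_multigraph d G \<longrightarrow> spectral_gap d G \<ge> \<alpha> \<longrightarrow> u \<ge> 0 \<longrightarrow>
       stationary_walk d G M X \<longrightarrow>
       (\<forall>i\<in>{0..d}.
          measure M {\<omega> \<in> space M.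
            \<bar>real (num_degree G (vacant_degree G X u \<omega>) i)
              - (\<integral>\<omega>'. real (num_degree G (vacant_degree G X u \<omega>') i) \<partial>M)\<bar>
            \<ge> real (card (verts G)) powr (1/2 + \<epsilon>)}
          \<le> c\<^sub>\<epsilon> * exp (- c * real (card (verts G)) powr \<epsilon>))"
proof (rule allI, rule exI[of _ "1 / 2"], intro conjI allI impI ballI)
  fix d :: nat and \<alpha> \<epsilon> :: real
  assume \<alpha>: "0 < \<alpha>" and "\<epsilon> \<in> {0<..<1/4}"
  then have \<epsilon>: "0 < \<epsilon>" by simp
  \<comment> \<open>These are the coefficients of \<open>B\<close>, for the constant
    \<open>L = 2 * d + 1\<close>, written as \<open>a + b * ln n\<close>.\<close>
  define a where "a = 8 * (2 * real d + 1) + 2"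
  define b where "b = 4 * (2 * real d + 1) / \<alpha>"
  have ab: "0 < a" "0 < b" using \<alpha> by (auto simp: a_def b_def add_pos_nonneg)
  have "0 < 1 / \<alpha>" using \<alpha> by simp
  from log_factors_negligible[OF ab this \<epsilon>] obtain x0 where x0: "\<And>x. x0 \<le> x \<Longrightarrow>
    2 * (a + b * ln x) \<le> sqrt x \<and> 4 \<le> x powr (1 / 2 + \<epsilon>) \<and>
    (2 / sqrt x)\<^sup>2 * (a + b * ln x)\<^sup>2 * (1 + (2 * x * ln x + 1) * (ln (2 * x) * (1 / \<alpha>))) \<le> x powr \<epsilon> / 2"
    unfolding eventually_at_top_linorder by blast
  \<comment> \<open>The 2 comes from the two tails. The exponential makes the bound at least 1,
    hence trivial, for graphs with fewer than \<open>x0\<close> vertices. As \<open>x0\<close>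
    carries the dependence on \<alpha>, the rate 1/2 stays absolute.\<close>
  define C where "C = 2 + exp (1 / 2 * \<bar>x0\<bar> powr \<epsilon>)"
  have main: "measure M {\<omega> \<in> space M.
            \<bar>real (num_degree G (vacant_degree G X u \<omega>) i)
              - (\<integral>\<omega>'. real (num_degree G (vacant_degree G X u \<omega>') i) \<partial>M)\<bar>
            \<ge> real (card (verts G)) powr (1/2 + \<epsilon>)}
          \<le> C * exp (- (1 / 2) * real (card (verts G)) powr \<epsilon>)"
    if "regular_multigraph d G" "spectral_gap d G \<ge> \<alpha>" and u: "u \<ge> 0" and "stationary_walk d G M X"
    for G :: "('v, 'e) multigraph" and M :: "'w measure" and X :: "real \<Rightarrow> 'w \<Rightarrow> 'v" and u :: real and i :: nat
  proof -
    interpret gapped_walk d G M X \<alpha>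
      using that \<alpha> by unfold_locales
    let ?P = "prob {\<omega> \<in> space M. \<bar>degree_count i (path_range (u * n) \<omega>) -
      expectation (\<lambda>\<omega>. degree_count i (path_range (u * n) \<omega>))\<bar> \<ge> n powr (1 / 2 + \<epsilon>)}"
    have "?P \<le> C * exp (- (1 / 2) * n powr \<epsilon>)"
    proof (cases "x0 \<le> n")
      case True
      note * = x0[OF this]
      have n0: "0 < n" using n_ge_1 by simp
      define B where "B = 2 * (2 * real d + 1) * (4 + 2 * ln n / \<alpha>) + 2"
      have B: "B = a + b * ln n" by (simp add: B_def a_def b_def algebra_simps)
      \<comment> \<open>Then \<theta> times half the threshold is \<open>n powr \<epsilon>\<close>.
        The error exponent consumes at most half of it and leaves the rate 1/2.\<close>
      define \<theta> where "\<theta> = 2 / sqrt n"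
      have \<theta>: "0 < \<theta>" "\<theta> * B \<le> 1" using * n0 by (auto simp: \<theta>_def B field_simps)
      have half: "n powr (1 / 2 + \<epsilon>) = sqrt n * n powr \<epsilon>" using n0 by (simp add: powr_add powr_half_sqrt)
      have "?P \<le> 2 * exp (- \<theta> * (n powr (1 / 2 + \<epsilon>) / 2) + \<theta>\<^sup>2 * B\<^sup>2 * (1 + cover_time))"
        using u n0 * by (intro degree_count_deviation[OF _ B_def \<theta>]) auto
      also have "\<dots> \<le> 2 * exp (- (1 / 2) * n powr \<epsilon>)"
      proof -
        have "\<theta> * (n powr (1 / 2 + \<epsilon>) / 2) = n powr \<epsilon>" using n0 by (simp add: half \<theta>_def)
        moreover have "\<theta>\<^sup>2 * B\<^sup>2 * (1 + cover_time) \<le> n powr \<epsilon> / 2"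
          using * by (simp add: \<theta>_def B cover_time_def)
        ultimately show ?thesis by simp
      qed
      also have "\<dots> \<le> C * exp (- (1 / 2) * n powr \<epsilon>)"
        by (intro mult_right_mono) (auto simp: C_def)
      finally show ?thesis .
    next
      case False
      then have "n powr \<epsilon> \<le> \<bar>x0\<bar> powr \<epsilon>" using n_ge_1 \<epsilon> by (intro powr_mono2) auto
      then have "1 \<le> exp (1 / 2 * \<bar>x0\<bar> powr \<epsilon>) * exp (- (1 / 2) * n powr \<epsilon>)"
        by (simp flip: exp_add)
      also have "\<dots> \<le> C * exp (- (1 / 2) * n powr \<epsilon>)"
        by (intro mult_right_mono) (auto simp: C_def)
      finally show ?thesis using prob_le_1 order.trans by blast
    qed
    then show ?thesis by (simp only: degree_count_vacant)
  qed
  have "0 < C" by (simp add: C_def add_pos_pos)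
  then show "\<exists>c\<^sub>\<epsilon>>0::real.
     \<forall>(G :: ('v, 'e) multigraph) (M :: 'w measure) (X :: real \<Rightarrow> 'w \<Rightarrow> 'v) (u::real).
       regular_multigraph d G \<longrightarrow> spectral_gap d G \<ge> \<alpha> \<longrightarrow> u \<ge> 0 \<longrightarrow>
       stationary_walk d G M X \<longrightarrow>
       (\<forall>i\<in>{0..d}.
          measure M {\<omega> \<in> space M.
            \<bar>real (num_degree G (vacant_degree G X u \<omega>) i)
              - (\<integral>\<omega>'. real (num_degree G (vacant_degree G X u \<omega>') i) \<partial>M)\<bar>
            \<ge> real (card (verts G)) powr (1/2 + \<epsilon>)}
          \<le> c\<^sub>\<epsilon> * exp (- (1 / 2) * real (card (verts G)) powr \<epsilon>))"
    using main by blast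
qed simp

end
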